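(* Let $m\ge1$, $n\ge1$ be integers with $m+n\ge3$, and let $K_{m,n}$ be the complete bipartite graph on the vertex set $\{x_1,\ldots,x_m\}\sqcup\{x_{m+1},\ldots,x_{m+n}\}$. The Gorenstein polytopes of the form $\operatorname{conv}(\mathcal{D}(K_{m,n},\mathfrak{c}))$, with $\mathfrak{c}=(c_1,\ldots,c_{m+n})\in(\mathbb{Z}_{>0})^{m+n}$, are those of the following two families: (1) $m=n$, and $c_1=\cdots=c_{2n}=1$ or $c_1=\cdots=c_{2n}=2$: the polytopes are, respectively, $\mathcal{Q}_{2n}\subset\mathbb{R}^{2n}$ and $\mathcal{Q}_{2n}'+(1,\ldots,1)\subset\mathbb{R}^{2n}$. (2) $n=2m-1$ with $m\ge2$, and $A$ is a subset of $\{m+1,\ldots,m+n\}$ (possibly $A=\emptyset$ or $A=\{m+1,\ldots,m+n\}$): (a) for $c_i=1$ if $i\in\{1,\ldots,m+n\}\setminus A$ and $c_i=m$ if $i\in A$, the polytope defined by the linear inequalities $0\le x_i$ for $i\in\{1,\ldots,m+n\}$, $x_i\le1$ for $i\notin A$, together with $x_{m+1}+\cdots+x_{m+n}\le m$; (b) for $c_i=2$ if $i\in\{1,\ldots,m+n\}\setminus A$ and $c_i=2m$ if $i\in A$, the polytope defined by the linear inequalities $0\le x_i$ for $i\in\{1,\ldots,m+n\}$, $x_i\le2$ for $i\notin A$, together with $x_{m+1}+\cdots+x_{m+n}\le 2m$.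
   Context: Let $N\ge 3$ and let $G$ be a finite graph on the vertex set $V(G)=\{x_1,\ldots,x_N\}$ with no loops, no multiple edges and no isolated vertices. Let $S=K[x_1,\ldots,x_N]$ be the polynomial ring over a field $K$ and let $I(G)\subset S$ be the edge ideal, generated by the monomials $x_ix_j$ with $\{x_i,x_j\}\in E(G)$. For $\mathfrak{c}=(c_1,\ldots,c_N)\in(\mathbb{Z}_{>0})^N$ and an integer $q\ge1$, $(I(G)^q)_{\mathfrak{c}}$ is the ideal generated by the monomials $x_1^{a_1}\cdots x_N^{a_N}\in I(G)^q$ with $a_i\le c_i$ for all $i$. Let $\delta_{\mathfrak{c}}(I(G))$ be the largest $q$ with $(I(G)^q)_{\mathfrak{c}}\ne(0)$, and let $\mathcal{B}(G,\mathfrak{c})$ be the minimal set of monomial generators of $(I(G)^{\delta_{\mathfrak{c}}(I(G))})_{\mathfrak{c}}$. Let $\mathcal{D}(G,\mathfrak{c})$ be the set of vectors $(a_1,\ldots,a_N)\in\mathbb{Z}_{\ge0}^N$ such that $x_1^{a_1}\cdots x_N^{a_N}$ divides some $u\in\mathcal{B}(G,\mathfrak{c})$, and let $\operatorname{conv}(\mathcal{D}(G,\mathfrak{c}))\subset\mathbb{R}^N$ be its convex hull. A lattice polytope (all vertices in $\mathbb{Z}^N$) $\mathcal{P}\subset\mathbb{R}^N$ of dimension $N$ is reflexive if the origin lies in its interior and its dual $\mathcal{P}^\vee=\{x\in\mathbb{R}^N:\sum_i x_iy_i\le1\ \forall y\in\mathcal{P}\}$ is a lattice polytope. A lattice polytope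 $\mathcal{P}\subset\mathbb{R}^N$ of dimension $N$ is Gorenstein if there are an integer $\delta>0$ and $\mathbf{a}\in\mathbb{Z}^N$ such that $\delta\mathcal{P}-\mathbf{a}$ is reflexive. $\mathcal{Q}_N=[0,1]^N\subset\mathbb{R}^N$ is the standard unit cube and $\mathcal{Q}_N'=2\mathcal{Q}_N-(1,\ldots,1)=[-1,1]^N$, so $\mathcal{Q}_N'+(1,\ldots,1)=[0,2]^N$. The edges of $K_{m,n}$ are all $\{x_i,x_j\}$ with $1\le i\le m$ and $m+1\le j\le m+n$. In the inequalities defining polytopes, $x_1,\ldots,x_{m+n}$ denote the coordinates of $\mathbb{R}^{m+n}$.
   Formalization: The list as stated fails when m=2n−1, n≥2 (e.g. K_{3,2}, c=(1,…,1)); the formal theorem proves it for m≠2n−1, and for all m,n proves it with the mirror images of the polytopes listed for K_{n,m} (parts exchanged) added. *)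

theory Defs
  imports "HOL-Analysis.Analysis" "HOL-Library.Poly_Mapping"
begin

text \<open>
  The polynomial ring over the field \<open>'k\<close> in the variables \<open>x\<^sub>v\<close>, for \<open>v\<close> in the finite type \<open>'v\<close>,
  is the monoid algebra \<open>('v \<Rightarrow>\<^sub>0 nat) \<Rightarrow>\<^sub>0 'k\<close>, with the convolution product of
  \<open>HOL-Library.Poly_Mapping\<close>.
\<close>

type_synonym ('v, 'k) mpol = "('v \<Rightarrow>\<^sub>0 nat) \<Rightarrow>\<^sub>0 'k"

definition indet :: "'v \<Rightarrow> ('v, 'k::field) mpol" where
  "indet v = Poly_Mapping.single (Poly_Mapping.single v 1) 1"

definition monomial_of :: "('v::finite \<Rightarrow> nat) \<Rightarrow> ('v, 'k::field) mpol" where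
  "monomial_of a = (\<Prod>v\<in>UNIV. indet v ^ a v)"

text \<open>The span in a commutative ring regarded as a module over itself.\<close>

definition ideal_gen :: "'r::comm_ring_1 set \<Rightarrow> 'r set" where
  "ideal_gen B = module.span (*) B"

primrec ideal_pow :: "'r::comm_ring_1 set \<Rightarrow> nat \<Rightarrow> 'r set" where
  "ideal_pow I 0 = UNIV"
| "ideal_pow I (Suc q) = ideal_gen {f * g | f g. f \<in> I \<and> g \<in> ideal_pow I q}"

text \<open>
  The minimal set of monomial generators of a monomial ideal: the unique set of monomials that
  generates the ideal and has no proper subset that generates it.
\<close>

definition min_monomial_gens :: "('v::finite, 'k::field) mpol set \<Rightarrow> ('v, 'k) mpol set" where
  "min_monomial_gens J = (THE B. B \<subseteq> range monomial_of \<and> ideal_gen B = J \<and>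
     (\<forall>B'. B' \<subset> B \<longrightarrow> ideal_gen B' \<noteq> J))"

text \<open>
  A graph on the vertex set \<open>UNIV :: 'v set\<close> is given by its set of edges, each edge being a
  two-element set of vertices.
\<close>

definition edge_ideal :: "'v::finite set set \<Rightarrow> ('v, 'k::field) mpol set" where
  "edge_ideal E = ideal_gen {indet i * indet j | i j. {i, j} \<in> E}"

definition bounded_part ::
    "('v::finite \<Rightarrow> nat) \<Rightarrow> ('v, 'k::field) mpol set \<Rightarrow> ('v, 'k) mpol set" where
  "bounded_part c J =
     ideal_gen {monomial_of a | a. monomial_of a \<in> J \<and> (\<forall>i. a i \<le> c i)}"

definition delta :: "('v::finite \<Rightarrow> nat) \<Rightarrow> ('v, 'k::field) mpol set \<Rightarrow> nat" where
  "delta c I = (GREATEST q. 1 \<le> q \<and> bounded_part c (ideal_pow I q) \<noteq> {0})"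

text \<open>The set \<open>\<B>(G, \<cc>)\<close>.\<close>

definition top_gens ::
    "'v::finite set set \<Rightarrow> ('v \<Rightarrow> nat) \<Rightarrow> ('v, 'k::field) mpol set" where
  "top_gens E c =
     (let I = edge_ideal E in min_monomial_gens (bounded_part c (ideal_pow I (delta c I))))"

text \<open>
  The set \<open>\<D>(G, \<cc>)\<close>. The coefficient field does not occur in the type of the result and so is
  passed as a type argument.
\<close>

definition divisor_vectors ::
    "'k::field itself \<Rightarrow> 'v::finite set set \<Rightarrow> ('v \<Rightarrow> nat) \<Rightarrow> ('v \<Rightarrow> nat) set" where
  "divisor_vectors _ E c =
     {a. \<exists>u \<in> top_gens E c. (monomial_of a :: ('v, 'k) mpol) dvd u}"

definition conv_D ::
    "'k::field itself \<Rightarrow> 'v::finite set set \<Rightarrow> ('v \<Rightarrow> nat) \<Rightarrow> (real ^ 'v) set" where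
  "conv_D K E c = convex hull ((\<lambda>a. \<chi> i. real (a i)) ` divisor_vectors K E c)"

text \<open>
  \<open>K\<^sub>m\<^sub>,\<^sub>n\<close> for \<open>m = CARD('m)\<close> and \<open>n = CARD('n)\<close>: the vertices \<open>x\<^sub>1, \<dots>, x\<^sub>m\<close> are the \<open>Inl i\<close>,
  and \<open>x\<^sub>m\<^sub>+\<^sub>1, \<dots>, x\<^sub>m\<^sub>+\<^sub>n\<close> are the \<open>Inr j\<close>.
\<close>

definition complete_bipartite :: "('m + 'n) set set" where
  "complete_bipartite = {{Inl i, Inr j} | i j. True}"

definition lattice_polytope :: "(real ^ 'v::finite) set \<Rightarrow> bool" where
  "lattice_polytope P \<longleftrightarrow> polytope P \<and> (\<forall>x. x extreme_point_of P \<longrightarrow> (\<forall>i. x $ i \<in> \<int>))"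

definition dual_polytope :: "(real ^ 'v::finite) set \<Rightarrow> (real ^ 'v) set" where
  "dual_polytope P = {x. \<forall>y\<in>P. (\<Sum>i\<in>UNIV. x $ i * y $ i) \<le> 1}"

definition reflexive_polytope :: "(real ^ 'v::finite) set \<Rightarrow> bool" where
  "reflexive_polytope P \<longleftrightarrow> lattice_polytope P \<and> aff_dim P = int CARD('v) \<and>
     0 \<in> interior P \<and> lattice_polytope (dual_polytope P)"

definition gorenstein_polytope :: "(real ^ 'v::finite) set \<Rightarrow> bool" where
  "gorenstein_polytope P \<longleftrightarrow> lattice_polytope P \<and> aff_dim P = int CARD('v) \<and>
     (\<exists>(d::nat) (a :: int ^ 'v). 0 < d \<and>
        reflexive_polytope ((\<lambda>x. real d *\<^sub>R x - (\<chi> i. real_of_int (a $ i))) ` P))"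

text \<open>The polytopes \<open>\<Q>\<^sub>N\<close> and \<open>\<Q>\<^sub>N'\<close>; here \<open>1\<close> is the vector \<open>(1, \<dots>, 1)\<close>.\<close>

definition unit_cube :: "(real ^ 'v::finite) set" where
  "unit_cube = {x. \<forall>i. 0 \<le> x $ i \<and> x $ i \<le> 1}"

definition centred_cube :: "(real ^ 'v::finite) set" where
  "centred_cube = (\<lambda>x. 2 *\<^sub>R x - 1) ` unit_cube"

definition gorenstein_bipartite_polytopes ::
    "'k::field itself \<Rightarrow> (real ^ ('m::finite + 'n::finite)) set set" where
  "gorenstein_bipartite_polytopes K =
     {P. gorenstein_polytope P \<and> (\<exists>c. (\<forall>i. 0 < c i) \<and> P = conv_D K complete_bipartite c)}"

text \<open>
  \<open>family1 c P\<close> and \<open>family2 c P\<close> state that \<open>P\<close> is the polytope listed for the bound vector \<open>c\<close>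
  in the respective family. The set \<open>A\<close> of vertices in the second part is given by a set of \<open>j :: 'n\<close>.
\<close>

definition family1 :: "('m::finite + 'n::finite \<Rightarrow> nat) \<Rightarrow> (real ^ ('m + 'n)) set \<Rightarrow> bool" where
  "family1 c P \<longleftrightarrow> CARD('m) = CARD('n) \<and>
     ((\<forall>i. c i = 1) \<and> P = unit_cube \<or>
      (\<forall>i. c i = 2) \<and> P = (\<lambda>x. x + 1) ` centred_cube)"

definition family2 :: "('m::finite + 'n::finite \<Rightarrow> nat) \<Rightarrow> (real ^ ('m + 'n)) set \<Rightarrow> bool" where
  "family2 c P \<longleftrightarrow> CARD('m) \<ge> 2 \<and> CARD('n) = 2 * CARD('m) - 1 \<and>
     (\<exists>A :: 'n set.
        (\<forall>i. c i = (if i \<in> Inr ` A then CARD('m) else 1)) \<and>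
        P = {x. (\<forall>i. 0 \<le> x $ i) \<and> (\<forall>i. i \<notin> Inr ` A \<longrightarrow> x $ i \<le> 1) \<and>
                (\<Sum>j\<in>UNIV. x $ Inr j) \<le> real CARD('m)}
      \<or>
        (\<forall>i. c i = (if i \<in> Inr ` A then 2 * CARD('m) else 2)) \<and>
        P = {x. (\<forall>i. 0 \<le> x $ i) \<and> (\<forall>i. i \<notin> Inr ` A \<longrightarrow> x $ i \<le> 2) \<and>
                (\<Sum>j\<in>UNIV. x $ Inr j) \<le> 2 * real CARD('m)})"

definition listed_polytopes :: "(real ^ ('m::finite + 'n::finite)) set set" where
  "listed_polytopes = {P. \<exists>c. family1 c P \<or> family2 c P}"

text \<open>
  The coordinate permutation induced by exchanging the two parts, \<open>K\<^sub>n\<^sub>,\<^sub>m \<cong> K\<^sub>m\<^sub>,\<^sub>n\<close>. It is needed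
  since the second family is not symmetric in the two parts: for \<open>m = 2n - 1\<close> with \<open>n \<ge> 2\<close> the
  Gorenstein polytopes are those listed for \<open>K\<^sub>n\<^sub>,\<^sub>m\<close>, with the parts exchanged.
\<close>

definition swap_parts :: "(real ^ ('n::finite + 'm::finite)) set \<Rightarrow> (real ^ ('m + 'n)) set" where
  "swap_parts P = (\<lambda>x. \<chi> i. x $ (case i of Inl k \<Rightarrow> Inr k | Inr k \<Rightarrow> Inl k)) ` P"

end

theory Submission
  imports Defs
begin

text \<open>
  For \<open>G = K\<^sub>m\<^sub>,\<^sub>n\<close> let \<open>l\<close> and \<open>r\<close> be the sums of \<open>\<cc>\<close> over the two parts. The power \<open>I(G)\<^sup>q\<close> is
  spanned by the monomials of degree at least \<open>q\<close> in each group of variables, so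
  \<open>\<delta> = min l r\<close>, and if \<open>l \<le> r\<close> then \<open>conv \<D>\<close> is the box \<open>[0, \<cc>]\<close> cut by the single inequality
  bounding the sum over the second part by \<open>l\<close>; its vertices are integral by a perturbation
  argument. If \<open>d P - a\<close> is reflexive then all its facets have lattice distance 1 from the origin.
  The facets \<open>x\<^sub>i \<ge> 0\<close> force \<open>a = (1, \<dots>, 1)\<close>, the facets \<open>x\<^sub>i \<le> c\<^sub>i\<close> force \<open>d c\<^sub>i = 2\<close>, and the
  remaining facet, present iff \<open>l < r\<close>, forces \<open>d l = n + 1\<close>, that is \<open>n = 2 m - 1\<close>. Bounds
  \<open>c\<^sub>i \<ge> l\<close> on the second part define no facet and are free, which is the set \<open>A\<close>. Conversely,
  the facet normals of these polytopes are the vertices of the dual.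
\<close>

subsection \<open>Monomial ideals\<close>

lemma module_self: "module ((*) :: 'r::comm_ring_1 \<Rightarrow> 'r \<Rightarrow> 'r)"
  by unfold_locales (simp_all add: algebra_simps)

lemma ideal_gen_base: "b \<in> B \<Longrightarrow> b \<in> ideal_gen B"
  unfolding ideal_gen_def by (rule module.span_base[OF module_self])

lemma ideal_gen_mult: "b \<in> ideal_gen B \<Longrightarrow> r * b \<in> ideal_gen B"
  unfolding ideal_gen_def by (rule module.span_scale[OF module_self])

lemma ideal_gen_sum: "(\<And>x. x \<in> X \<Longrightarrow> f x \<in> ideal_gen B) \<Longrightarrow> sum f X \<in> ideal_gen B"
  unfolding ideal_gen_def by (rule module.span_sum[OF module_self])

lemma ideal_gen_induct [consumes 1, case_names zero add mult base]:
  assumes "x \<in> ideal_gen B" "P 0" "\<And>x y. P x \<Longrightarrow> P y \<Longrightarrow> P (x + y)"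
    "\<And>r x. P x \<Longrightarrow> P (r * x)" "\<And>b. b \<in> B \<Longrightarrow> P b"
  shows "P x"
proof -
  have "module.subspace (*) {x. P x}"
    unfolding module.subspace_def[OF module_self] using assms(2,3,4) by auto
  from module.span_induct[OF module_self assms(1)[unfolded ideal_gen_def] this]
  show ?thesis using assms(5) by auto
qed

lemma ideal_gen_eq_zero_iff: "ideal_gen B = {0} \<longleftrightarrow> B \<subseteq> {0}"
proof
  assume "B \<subseteq> {0}"
  have "x = 0" if "x \<in> ideal_gen B" for x
    using that(1) by (induction rule: ideal_gen_induct) (use \<open>B \<subseteq> {0}\<close> in auto)
  moreover have "0 \<in> ideal_gen B"
    using ideal_gen_sum[of "{}"] by simp
  ultimately show "ideal_gen B = {0}" by auto
qed (use ideal_gen_base in blast)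

lemma indet_power: "indet v ^ n = Poly_Mapping.single (Poly_Mapping.single v n) 1"
  by (induction n) (simp_all add: indet_def mult_single single_add[symmetric])

lemma monomial_of_eq_single:
  "(monomial_of a :: ('v::finite, 'k::field) mpol) = Poly_Mapping.single (Abs_poly_mapping a) 1"
proof -
  have "(\<Prod>v\<in>S. indet v ^ a v :: ('v, 'k) mpol)
      = Poly_Mapping.single (\<Sum>v\<in>S. Poly_Mapping.single v (a v)) 1" if "finite S" for S
    using that by (induction S rule: finite_induct) (simp_all add: indet_power mult_single)
  moreover have "(\<Sum>v\<in>UNIV. Poly_Mapping.single v (a v)) = Abs_poly_mapping a"
    by (rule poly_mapping_eqI) (simp add: lookup_sum lookup_single when_def)
  ultimately show ?thesis by (simp add: monomial_of_def)
qed

lemma keys_monomial_of: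
  "Poly_Mapping.keys (monomial_of a :: ('v::finite, 'k::field) mpol) = {Abs_poly_mapping a}"
  by (simp add: monomial_of_eq_single)

lemma monomial_of_neq_0: "(monomial_of a :: ('v::finite, 'k::field) mpol) \<noteq> 0"
  using keys_monomial_of[of a] by (metis insert_not_empty keys_zero)

lemma monomial_of_mult:
  "(monomial_of a * monomial_of b :: ('v::finite, 'k::field) mpol) = monomial_of (\<lambda>v. a v + b v)"
  by (simp add: monomial_of_def power_add prod.distrib)

lemma indet_eq_monomial_of: "(indet w :: ('v::finite, 'k::field) mpol) = monomial_of (\<lambda>v. if v = w then 1 else 0)"
proof -
  have "(monomial_of (\<lambda>v. if v = w then 1 else 0) :: ('v, 'k) mpol) = (\<Prod>v\<in>UNIV. if v = w then indet v else 1)"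
    unfolding monomial_of_def by (rule prod.cong) auto
  then show ?thesis by (simp only: prod.delta finite UNIV_I if_True)
qed

text \<open>Coefficients enter as constants \<open>Poly_Mapping.single 0 _\<close> acting by
  multiplication, so that ideal membership of \<open>f\<close> follows from that of its
  monomials.\<close>

lemma mpol_eq_sum_monomials:
  fixes f :: "('v::finite, 'k::field) mpol"
  shows "f = (\<Sum>k\<in>Poly_Mapping.keys f. Poly_Mapping.single 0 (Poly_Mapping.lookup f k) * monomial_of (Poly_Mapping.lookup k))"
    (is "f = ?g")
proof (rule poly_mapping_eqI)
  fix k
  have "Abs_poly_mapping (Poly_Mapping.lookup k') = k'" for k' :: "'v \<Rightarrow>\<^sub>0 nat"
    by (rule lookup_inverse)
  then have "Poly_Mapping.lookup ?g k = (\<Sum>k'\<in>Poly_Mapping.keys f. Poly_Mapping.lookup f k' when k' = k)"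
    by (simp add: monomial_of_eq_single mult_single lookup_sum lookup_single)
  also have "\<dots> = Poly_Mapping.lookup f k"
    by (simp add: when_def in_keys_iff sum.delta)
  finally show "Poly_Mapping.lookup f k = Poly_Mapping.lookup ?g k" by simp
qed

lemma mem_ideal_genI:
  fixes f :: "('v::finite, 'k::field) mpol"
  assumes "\<And>k. k \<in> Poly_Mapping.keys f \<Longrightarrow> monomial_of (Poly_Mapping.lookup k) \<in> ideal_gen B"
  shows "f \<in> ideal_gen B"
  by (subst mpol_eq_sum_monomials) (auto intro!: ideal_gen_sum ideal_gen_mult assms)

lemma monomial_dvd_monomialI:
  assumes "\<And>v. a v \<le> b v"
  shows "(monomial_of a :: ('v::finite, 'k::field) mpol) dvd monomial_of b"
proof
  show "(monomial_of b :: ('v, 'k) mpol) = monomial_of a * monomial_of (\<lambda>v. b v - a v)"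
    using assms by (simp add: monomial_of_mult)
qed

text \<open>Having every exponent above some element of \<open>A\<close> survives sums, and it
  survives multiplication because each exponent of a product is a sum of exponents of the
  factors.\<close>

lemma keys_ideal_gen_monomials:
  assumes "f \<in> ideal_gen (monomial_of ` A :: ('v::finite, 'k::field) mpol set)" "k \<in> Poly_Mapping.keys f"
  shows "\<exists>a\<in>A. \<forall>v. a v \<le> Poly_Mapping.lookup k v"
  using assms
proof (induction arbitrary: k rule: ideal_gen_induct)
  case (add x y)
  then show ?case using keys_add[of x y] by blast
next
  case (mult r x)
  from mult.prems obtain k1 k2 where k: "k = k1 + k2" "k2 \<in> Poly_Mapping.keys x"
    using keys_mult[of r x] by blast
  from mult.IH[OF k(2)] show ?case unfolding k(1) lookup_add by (blast intro: trans_le_add2)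
next
  case (base b)
  then show ?case by (auto simp: keys_monomial_of)
qed auto

text \<open>Membership in a monomial ideal is decided on the support. Two monomial ideals thus agree
  as soon as their generators have the same upward closure, which is how they are compared
  below.\<close>

lemma ideal_gen_monomials:
  "ideal_gen (monomial_of ` A :: ('v::finite, 'k::field) mpol set)
    = {f. \<forall>k\<in>Poly_Mapping.keys f. \<exists>a\<in>A. \<forall>v. a v \<le> Poly_Mapping.lookup k v}"
proof (intro equalityI subsetI)
  fix f assume f: "f \<in> {f :: ('v, 'k) mpol. \<forall>k\<in>Poly_Mapping.keys f. \<exists>a\<in>A. \<forall>v. a v \<le> Poly_Mapping.lookup k v}"
  show "f \<in> ideal_gen (monomial_of ` A)"
  proof (rule mem_ideal_genI)
    fix k assume "k \<in> Poly_Mapping.keys f"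
    with f obtain a where a: "a \<in> A" "\<And>v. a v \<le> Poly_Mapping.lookup k v" by blast
    then obtain h where "monomial_of (Poly_Mapping.lookup k) = (monomial_of a :: ('v, 'k) mpol) * h"
      using monomial_dvd_monomialI[of a "Poly_Mapping.lookup k", where 'k = 'k] by auto
    then show "monomial_of (Poly_Mapping.lookup k) \<in> ideal_gen (monomial_of ` A :: ('v, 'k) mpol set)"
      using ideal_gen_mult[OF ideal_gen_base, of "monomial_of a" "monomial_of ` A" h] a
      by (simp add: mult.commute)
  qed
qed (use keys_ideal_gen_monomials in auto)

lemma monomial_in_ideal_gen_iff:
  "monomial_of b \<in> ideal_gen (monomial_of ` A :: ('v::finite, 'k::field) mpol set)
    \<longleftrightarrow> (\<exists>a\<in>A. \<forall>v. a v \<le> b v)"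
  by (simp add: ideal_gen_monomials keys_monomial_of)

text \<open>A multiple of \<open>monomial_of a\<close> lies in the monomial ideal generated by
  \<open>a\<close> alone, where membership is already known.\<close>

lemma monomial_dvd_iff:
  "(monomial_of a :: ('v::finite, 'k::field) mpol) dvd monomial_of b \<longleftrightarrow> (\<forall>v. a v \<le> b v)"
proof
  assume "(monomial_of a :: ('v, 'k) mpol) dvd monomial_of b"
  then obtain h :: "('v, 'k) mpol" where "monomial_of b = monomial_of a * h" by (elim dvdE)
  then have "(monomial_of b :: ('v, 'k) mpol) \<in> ideal_gen (monomial_of ` {a})"
    using ideal_gen_mult[OF ideal_gen_base, of "monomial_of a" "monomial_of ` {a}" h]
    by (simp add: mult.commute)
  then show "\<forall>v. a v \<le> b v" by (simp only: monomial_in_ideal_gen_iff) auto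
qed (use monomial_dvd_monomialI in blast)

text \<open>In a generating set of monomials, every element of an antichain of generators must occur,
  since it can only be divisible by itself.\<close>

lemma antichain_subset_gens:
  assumes "ideal_gen (monomial_of ` A) = ideal_gen (monomial_of ` M :: ('v::finite, 'k::field) mpol set)"
    and anti: "\<And>a b. a \<in> M \<Longrightarrow> b \<in> M \<Longrightarrow> (\<And>v. a v \<le> b v) \<Longrightarrow> a = b"
  shows "M \<subseteq> A"
proof
  fix b assume b: "b \<in> M"
  then have "(monomial_of b :: ('v, 'k) mpol) \<in> ideal_gen (monomial_of ` A)"
    unfolding assms(1) by (intro ideal_gen_base) auto
  then obtain a where a: "a \<in> A" "\<forall>v. a v \<le> b v" unfolding monomial_in_ideal_gen_iff by blast
  then have "(monomial_of a :: ('v, 'k) mpol) \<in> ideal_gen (monomial_of ` M)"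
    unfolding assms(1)[symmetric] by (intro ideal_gen_base) auto
  then obtain b' where b': "b' \<in> M" "\<forall>v. b' v \<le> a v" unfolding monomial_in_ideal_gen_iff by blast
  have "b' = b" using anti[OF b'(1) b] a b' order_trans by metis
  then have "a = b" using a b' by (auto simp: fun_eq_iff intro: antisym)
  then show "b \<in> A" using a by simp
qed

text \<open>Every monomial generating set contains the antichain. This yields both minimality of the
  antichain and uniqueness, hence the value of the definite description.\<close>

lemma min_monomial_gens_antichain:
  assumes anti: "\<And>a b. a \<in> M \<Longrightarrow> b \<in> M \<Longrightarrow> (\<And>v. a v \<le> b v) \<Longrightarrow> a = b"
  shows "min_monomial_gens (ideal_gen (monomial_of ` M :: ('v::finite, 'k::field) mpol set))
    = monomial_of ` M"
  unfolding min_monomial_gens_def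
proof (rule the_equality)
  have "ideal_gen B' \<noteq> ideal_gen (monomial_of ` M)"
    if "B' \<subset> monomial_of ` M" for B' :: "('v, 'k) mpol set"
  proof
    assume eq: "ideal_gen B' = ideal_gen (monomial_of ` M)"
    from that obtain A where A: "B' = monomial_of ` A"
      by (meson psubset_imp_subset subset_image_iff)
    have "M \<subseteq> A" using antichain_subset_gens[OF eq[unfolded A] anti] .
    then show False using that A by blast
  qed
  then show "monomial_of ` M \<subseteq> range monomial_of \<and>
      ideal_gen (monomial_of ` M) = ideal_gen (monomial_of ` M :: ('v, 'k) mpol set) \<and>
      (\<forall>B'. B' \<subset> monomial_of ` M \<longrightarrow>
        ideal_gen B' \<noteq> ideal_gen (monomial_of ` M :: ('v, 'k) mpol set))"
    by (intro conjI image_mono subset_UNIV refl allI impI)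
next
  fix B :: "('v, 'k) mpol set"
  assume B: "B \<subseteq> range monomial_of \<and> ideal_gen B = ideal_gen (monomial_of ` M) \<and>
    (\<forall>B'. B' \<subset> B \<longrightarrow> ideal_gen B' \<noteq> ideal_gen (monomial_of ` M))"
  then obtain A where A: "B = monomial_of ` A" by (meson subset_image_iff)
  have "ideal_gen (monomial_of ` A) = ideal_gen (monomial_of ` M :: ('v, 'k) mpol set)"
    using B A by simp
  then have "M \<subseteq> A" using anti by (rule antichain_subset_gens)
  then have "monomial_of ` M \<subseteq> B" unfolding A by (rule image_mono)
  moreover have "\<not> monomial_of ` M \<subset> B" using B by metis
  ultimately show "B = monomial_of ` M" by blast
qed

subsection \<open>Powers of the edge ideal of a complete bipartite graph\<close>

abbreviation deg_Inl :: "('m::finite + 'n::finite \<Rightarrow> nat) \<Rightarrow> nat" where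
  "deg_Inl a \<equiv> \<Sum>i\<in>UNIV. a (Inl i)"

abbreviation deg_Inr :: "('m::finite + 'n::finite \<Rightarrow> nat) \<Rightarrow> nat" where
  "deg_Inr a \<equiv> \<Sum>j\<in>UNIV. a (Inr j)"

text \<open>The exponent of \<open>indet i * indet j\<close>. A sum of two indicators gives this
  also for \<open>i = j\<close>, so the product formula needs no case distinction.\<close>

definition edge_vector :: "'v \<Rightarrow> 'v \<Rightarrow> 'v \<Rightarrow> nat" where
  "edge_vector i j = (\<lambda>v. (if v = i then 1 else 0) + (if v = j then 1 else 0))"

lemma edge_ideal_complete_bipartite:
  "(edge_ideal complete_bipartite :: ('m::finite + 'n::finite, 'k::field) mpol set)
    = ideal_gen (monomial_of ` {edge_vector (Inl i) (Inr j) | i j. True})"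
proof -
  have prod: "indet i * indet j = (monomial_of (edge_vector i j) :: ('m + 'n, 'k) mpol)" for i j
    by (simp add: indet_eq_monomial_of monomial_of_mult edge_vector_def)
  have sym: "edge_vector i j = edge_vector j i" for i j :: "'m + 'n"
    by (auto simp: edge_vector_def)
  have "{indet i * indet j | i j. {i, j} \<in> complete_bipartite} =
      (monomial_of ` {edge_vector (Inl i) (Inr j) | i j. True} :: ('m + 'n, 'k) mpol set)"
    (is "?L = ?R")
  proof
    show "?L \<subseteq> ?R"
    proof
      fix x assume "x \<in> ?L"
      then obtain i j k l where "x = monomial_of (edge_vector i j)" "{i, j} = {Inl k, Inr l}"
        unfolding complete_bipartite_def prod by blast
      then have "x = monomial_of (edge_vector (Inl k) (Inr l))"
        using sym[of i j] by (auto simp: doubleton_eq_iff)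
      then show "x \<in> ?R" by blast
    qed
    show "?R \<subseteq> ?L" unfolding complete_bipartite_def prod by blast
  qed
  then show ?thesis by (simp add: edge_ideal_def)
qed

text \<open>Part degrees add under multiplication, which bounds them from below on the power.
  Conversely, any left vertex is joined to any right vertex, so edges can be split off a monomial as
  long as both part degrees are positive.\<close>

lemma ideal_pow_complete_bipartite:
  "ideal_pow (edge_ideal complete_bipartite :: ('m::finite + 'n::finite, 'k::field) mpol set) q
    = {f. \<forall>k\<in>Poly_Mapping.keys f. q \<le> deg_Inl (Poly_Mapping.lookup k) \<and> q \<le> deg_Inr (Poly_Mapping.lookup k)}"
proof (induction q)
  case (Suc q)
  let ?E = "{edge_vector (Inl i) (Inr j) | (i::'m) (j::'n). True}"
  let ?I = "ideal_gen (monomial_of ` ?E) :: ('m + 'n, 'k) mpol set"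
  let ?J = "{f :: ('m + 'n, 'k) mpol. \<forall>k\<in>Poly_Mapping.keys f. q \<le> deg_Inl (Poly_Mapping.lookup k) \<and> q \<le> deg_Inr (Poly_Mapping.lookup k)}"
  let ?B = "{f * g | f g. f \<in> ?I \<and> g \<in> ?J}"
  have deg: "deg_Inl (edge_vector (Inl i) (Inr j)) = 1" "deg_Inr (edge_vector (Inl i) (Inr j)) = 1"
    for i :: 'm and j :: 'n
    by (simp_all add: edge_vector_def)
  have I: "1 \<le> deg_Inl (Poly_Mapping.lookup k) \<and> 1 \<le> deg_Inr (Poly_Mapping.lookup k)" if fk: "f \<in> ?I" "k \<in> Poly_Mapping.keys f" for f k
  proof -
    obtain i j where "\<forall>v. edge_vector (Inl i) (Inr j) v \<le> Poly_Mapping.lookup k v"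
      using keys_ideal_gen_monomials[OF fk] by auto
    then have "deg_Inl (edge_vector (Inl i) (Inr j)) \<le> deg_Inl (Poly_Mapping.lookup k)"
      "deg_Inr (edge_vector (Inl i) (Inr j)) \<le> deg_Inr (Poly_Mapping.lookup k)"
      by (auto intro: sum_mono)
    then show ?thesis unfolding deg by blast
  qed
  have "ideal_gen ?B = {f. \<forall>k\<in>Poly_Mapping.keys f. Suc q \<le> deg_Inl (Poly_Mapping.lookup k) \<and> Suc q \<le> deg_Inr (Poly_Mapping.lookup k)}"
  proof (intro equalityI subsetI CollectI ballI)
    fix h k assume "h \<in> ideal_gen ?B" "k \<in> Poly_Mapping.keys h"
    then show "Suc q \<le> deg_Inl (Poly_Mapping.lookup k) \<and> Suc q \<le> deg_Inr (Poly_Mapping.lookup k)"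
    proof (induction arbitrary: k rule: ideal_gen_induct)
      case (add x y)
      then show ?case using keys_add[of x y] by blast
    next
      case (mult r x)
      from mult.prems obtain k1 k2 where "k = k1 + k2" "k2 \<in> Poly_Mapping.keys x"
        using keys_mult[of r x] by blast
      with mult.IH[of k2] show ?case by (auto simp: lookup_add sum.distrib intro: trans_le_add2)
    next
      case (base b)
      then obtain f g where fg: "b = f * g" "f \<in> ?I" "g \<in> ?J" by blast
      then obtain k1 k2 where k: "k = k1 + k2" "k1 \<in> Poly_Mapping.keys f" "k2 \<in> Poly_Mapping.keys g"
        using base keys_mult[of f g] by blast
      have "1 \<le> deg_Inl (Poly_Mapping.lookup k1) \<and> 1 \<le> deg_Inr (Poly_Mapping.lookup k1)" using I fg k by blast
      moreover have "q \<le> deg_Inl (Poly_Mapping.lookup k2) \<and> q \<le> deg_Inr (Poly_Mapping.lookup k2)" using fg k by blast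
      ultimately show ?case using k(1) by (simp add: lookup_add sum.distrib)
    qed simp
  next
    fix h :: "('m + 'n, 'k) mpol"
    assume h: "h \<in> {f. \<forall>k\<in>Poly_Mapping.keys f. Suc q \<le> deg_Inl (Poly_Mapping.lookup k) \<and> Suc q \<le> deg_Inr (Poly_Mapping.lookup k)}"
    show "h \<in> ideal_gen ?B"
    proof (rule mem_ideal_genI)
      fix k assume "k \<in> Poly_Mapping.keys h"
      then have k: "Suc q \<le> deg_Inl (Poly_Mapping.lookup k)" "Suc q \<le> deg_Inr (Poly_Mapping.lookup k)" using h by auto
      \<comment> \<open>A variable from each part divides the monomial, so the edge between them
        does too. Removing it lowers both part degrees by exactly 1, and the quotient lies in the
        \<open>q\<close>-th power.\<close>
      then obtain i j where ij: "0 < Poly_Mapping.lookup k (Inl i)" "0 < Poly_Mapping.lookup k (Inr j)"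
        by (metis Suc_le_lessD gr_zeroI less_nat_zero_code sum.neutral)
      let ?e = "edge_vector (Inl i) (Inr j)"
      define b where "b v = Poly_Mapping.lookup k v - ?e v" for v
      have le: "?e v \<le> Poly_Mapping.lookup k v" for v using ij by (auto simp: edge_vector_def)
      then have kb: "Poly_Mapping.lookup k = (\<lambda>v. ?e v + b v)" by (simp add: b_def)
      then have "deg_Inl (Poly_Mapping.lookup k) = deg_Inl ?e + deg_Inl b"
        "deg_Inr (Poly_Mapping.lookup k) = deg_Inr ?e + deg_Inr b"
        by (simp_all add: sum.distrib)
      then have "q \<le> deg_Inl b" "q \<le> deg_Inr b" using k unfolding deg by simp_all
      then have "monomial_of b \<in> ?J" by (simp add: keys_monomial_of)
      moreover have "monomial_of ?e \<in> ?I" by (rule ideal_gen_base) blast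
      ultimately have "(monomial_of ?e * monomial_of b) \<in> ideal_gen ?B"
        by (intro ideal_gen_base) blast
      then show "monomial_of (Poly_Mapping.lookup k) \<in> ideal_gen ?B"
        by (simp only: monomial_of_mult kb)
    qed
  qed
  then show ?case
    unfolding ideal_pow.simps Suc.IH unfolding edge_ideal_complete_bipartite .
qed simp

lemma bounded_part_complete_bipartite:
  "bounded_part c (ideal_pow (edge_ideal complete_bipartite :: ('m::finite + 'n::finite, 'k::field) mpol set) q)
    = ideal_gen (monomial_of ` {a. q \<le> deg_Inl a \<and> q \<le> deg_Inr a \<and> (\<forall>i. a i \<le> c i)})"
  unfolding bounded_part_def ideal_pow_complete_bipartite
  by (rule arg_cong[where f = ideal_gen]) (auto simp: keys_monomial_of)

lemma delta_complete_bipartite: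
  assumes "\<And>i. 0 < c i"
  shows "delta c (edge_ideal complete_bipartite :: ('m::finite + 'n::finite, 'k::field) mpol set)
    = min (deg_Inl c) (deg_Inr c)"
proof -
  have "bounded_part c (ideal_pow (edge_ideal complete_bipartite :: ('m + 'n, 'k) mpol set) q) \<noteq> {0}
      \<longleftrightarrow> q \<le> min (deg_Inl c) (deg_Inr c)" for q
  proof -
    have "(\<exists>a. q \<le> deg_Inl a \<and> q \<le> deg_Inr a \<and> (\<forall>i. a i \<le> c i)) \<longleftrightarrow> q \<le> min (deg_Inl c) (deg_Inr c)"
    proof
      assume "\<exists>a. q \<le> deg_Inl a \<and> q \<le> deg_Inr a \<and> (\<forall>i. a i \<le> c i)"
      then obtain a where a: "q \<le> deg_Inl a" "q \<le> deg_Inr a" "\<forall>i. a i \<le> c i" by blast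
      then have "deg_Inl a \<le> deg_Inl c" "deg_Inr a \<le> deg_Inr c" by (auto intro: sum_mono)
      with a show "q \<le> min (deg_Inl c) (deg_Inr c)" by simp
    qed (auto intro!: exI[of _ c])
    then show ?thesis
      unfolding bounded_part_complete_bipartite ideal_gen_eq_zero_iff
      using monomial_of_neq_0[where 'v = "'m + 'n" and 'k = 'k] by auto
  qed
  \<comment> \<open>\<open>delta\<close> ranges over exponents at least 1, so its value is the
    minimum only if that minimum is positive; this comes from the positivity of
    \<open>c\<close>.\<close>
  moreover have "1 \<le> min (deg_Inl c) (deg_Inr c)"
    using assms by (simp add: Suc_le_eq sum_pos)
  ultimately show ?thesis
    unfolding delta_def by (intro Greatest_equality) auto
qed

section \<open>Exponent vectors dividing the top generators\<close>

lemma exists_between_with_sum: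
  fixes a c :: "'v \<Rightarrow> nat"
  assumes "finite S" "\<And>i. i \<in> S \<Longrightarrow> a i \<le> c i" "sum a S \<le> k" "k \<le> sum c S"
  shows "\<exists>b. (\<forall>i\<in>S. a i \<le> b i \<and> b i \<le> c i) \<and> sum b S = k"
  using assms(2-4)
proof (induction "k - sum a S" arbitrary: a)
  case 0
  then show ?case by (intro exI[of _ a]) auto
next
  \<comment> \<open>A discrete intermediate value argument: some coordinate still lies below its
    bound, and raising it by 1 closes the gap to \<open>k\<close> by 1.\<close>
  case (Suc d)
  then have "sum a S < sum c S" by linarith
  then obtain j where j: "j \<in> S" "a j < c j" by (meson not_le sum_mono)
  define a' where "a' = a(j := Suc (a j))"
  have "sum a' S = Suc (sum a S)"
    using j assms(1) by (simp add: a'_def sum.remove[of S j])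
  moreover have "a' i \<le> c i" if "i \<in> S" for i using that j Suc.prems by (auto simp: a'_def)
  ultimately have "\<exists>b. (\<forall>i\<in>S. a' i \<le> b i \<and> b i \<le> c i) \<and> sum b S = k"
    using Suc by (intro Suc.hyps(1)) auto
  then show ?case unfolding a'_def
    by (metis Suc_leD fun_upd_other fun_upd_same)
qed

lemma divisor_vectors_complete_bipartite:
  fixes K :: "'k::field itself" and c :: "'m::finite + 'n::finite \<Rightarrow> nat"
  assumes c: "\<And>i. 0 < c i"
  defines "\<delta> \<equiv> min (deg_Inl c) (deg_Inr c)"
  shows "divisor_vectors K complete_bipartite c
    = {a. (\<forall>i. a i \<le> c i) \<and> deg_Inl a \<le> \<delta> \<and> deg_Inr a \<le> \<delta>}"
proof -
  \<comment> \<open>\<open>U\<close> holds the exponents that generate the bounded part by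
    definition, \<open>M\<close> those with both part degrees exactly \<delta>. The aim is that
    \<open>M\<close> is the minimal generating set.\<close>
  define U where "U = {a. \<delta> \<le> deg_Inl a \<and> \<delta> \<le> deg_Inr a \<and> (\<forall>i. a i \<le> c i)}"
  define M where "M = {a. deg_Inl a = \<delta> \<and> deg_Inr a = \<delta> \<and> (\<forall>i. a i \<le> c i)}"
  have ext: "\<exists>b\<in>M. \<forall>v. a v \<le> b v" if "\<And>i. a i \<le> c i" "deg_Inl a \<le> \<delta>" "deg_Inr a \<le> \<delta>" for a
  proof -
    have "\<exists>b. (\<forall>i\<in>UNIV. (a \<circ> Inl) i \<le> b i \<and> b i \<le> (c \<circ> Inl) i) \<and> sum b UNIV = \<delta>"
      using that by (intro exists_between_with_sum) (auto simp: \<delta>_def)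
    then obtain b1 where b1: "\<forall>i. a (Inl i) \<le> b1 i \<and> b1 i \<le> c (Inl i)" "sum b1 UNIV = \<delta>"
      by auto
    have "\<exists>b. (\<forall>i\<in>UNIV. (a \<circ> Inr) i \<le> b i \<and> b i \<le> (c \<circ> Inr) i) \<and> sum b UNIV = \<delta>"
      using that by (intro exists_between_with_sum) (auto simp: \<delta>_def)
    then obtain b2 where b2: "\<forall>i. a (Inr i) \<le> b2 i \<and> b2 i \<le> c (Inr i)" "sum b2 UNIV = \<delta>"
      by auto
    have "a v \<le> case_sum b1 b2 v \<and> case_sum b1 b2 v \<le> c v" for v
      using b1 b2 by (cases v) auto
    then show ?thesis using b1(2) b2(2) by (intro bexI[of _ "case_sum b1 b2"]) (auto simp: M_def)
  qed
  \<comment> \<open>Each part of an element of \<open>U\<close> can be lowered separately to sum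
    \<delta>. Hence \<open>U\<close> and \<open>M\<close> generate the same ideal.\<close>
  have below: "\<exists>b\<in>M. \<forall>v. b v \<le> a v" if "a \<in> U" for a
  proof -
    have "\<exists>b. (\<forall>i\<in>UNIV. 0 \<le> b i \<and> b i \<le> (a \<circ> Inl) i) \<and> sum b UNIV = \<delta>"
      using that by (intro exists_between_with_sum) (auto simp: U_def)
    then obtain b1 where b1: "\<forall>i. b1 i \<le> a (Inl i)" "sum b1 UNIV = \<delta>"
      by auto
    have "\<exists>b. (\<forall>i\<in>UNIV. 0 \<le> b i \<and> b i \<le> (a \<circ> Inr) i) \<and> sum b UNIV = \<delta>"
      using that by (intro exists_between_with_sum) (auto simp: U_def)
    then obtain b2 where b2: "\<forall>i. b2 i \<le> a (Inr i)" "sum b2 UNIV = \<delta>"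
      by auto
    have le: "case_sum b1 b2 v \<le> a v" for v
      using b1 b2 by (cases v) auto
    moreover have "a v \<le> c v" for v using that by (simp add: U_def)
    ultimately have "case_sum b1 b2 v \<le> c v" for v by (rule order_trans)
    then show ?thesis using b1(2) b2(2) le by (intro bexI[of _ "case_sum b1 b2"]) (auto simp: M_def)
  qed
  \<comment> \<open>On each part the two vectors have equal sums, so a pointwise inequality between
    them is an equality.\<close>
  have anti: "a = b" if M: "a \<in> M" "b \<in> M" and le: "\<And>v. a v \<le> b v" for a b
  proof
    fix v
    have "a (Inl i) = b (Inl i)" for i
      using sum_mono_inv[of "a \<circ> Inl" UNIV "b \<circ> Inl" i] M le by (auto simp: M_def)
    moreover have "a (Inr i) = b (Inr i)" for i
      using sum_mono_inv[of "a \<circ> Inr" UNIV "b \<circ> Inr" i] M le by (auto simp: M_def)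
    ultimately show "a v = b v" by (cases v) auto
  qed
  have "M \<subseteq> U" by (auto simp: M_def U_def)
  have "(\<exists>a\<in>U. \<forall>v. a v \<le> f v) \<longleftrightarrow> (\<exists>a\<in>M. \<forall>v. a v \<le> f v)" for f
    using below \<open>M \<subseteq> U\<close> by (meson order_trans subsetD)
  then have "ideal_gen (monomial_of ` U) = ideal_gen (monomial_of ` M :: ('m + 'n, 'k) mpol set)"
    by (simp add: ideal_gen_monomials)
  then have "top_gens complete_bipartite c
      = (min_monomial_gens (ideal_gen (monomial_of ` M)) :: ('m + 'n, 'k) mpol set)"
    by (simp only: top_gens_def Let_def delta_complete_bipartite[OF c]
        bounded_part_complete_bipartite U_def \<delta>_def)
  also have "\<dots> = monomial_of ` M"
    by (rule min_monomial_gens_antichain) (rule anti)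
  finally have "top_gens complete_bipartite c = (monomial_of ` M :: ('m + 'n, 'k) mpol set)" .
  then have "divisor_vectors K complete_bipartite c = {a. \<exists>b\<in>M. \<forall>v. a v \<le> b v}"
    by (simp add: divisor_vectors_def monomial_dvd_iff)
  also have "\<dots> = {a. (\<forall>i. a i \<le> c i) \<and> deg_Inl a \<le> \<delta> \<and> deg_Inr a \<le> \<delta>}"
  proof (intro equalityI subsetI)
    fix a assume "a \<in> {a. \<exists>b\<in>M. \<forall>v. a v \<le> b v}"
    then obtain b where b: "b \<in> M" "\<forall>v. a v \<le> b v" by blast
    have "deg_Inl a \<le> deg_Inl b" "deg_Inr a \<le> deg_Inr b" using b(2) by (simp_all add: sum_mono)
    moreover have "\<forall>i. a i \<le> c i" using b by (auto simp: M_def intro: order_trans)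
    ultimately show "a \<in> {a. (\<forall>i. a i \<le> c i) \<and> deg_Inl a \<le> \<delta> \<and> deg_Inr a \<le> \<delta>}"
      using b by (simp add: M_def)
  qed (use ext in auto)
  finally show ?thesis .
qed

subsection \<open>Boxes cut by one inequality\<close>

abbreviation natvec :: "('v::finite \<Rightarrow> nat) \<Rightarrow> real ^ 'v" where
  "natvec a \<equiv> \<chi> i. real (a i)"

text \<open>The common shape of all polytopes in question: \<open>T\<close> will be a part with the
  larger (or equal) sum of bounds, and \<open>k\<close> the sum of the bounds over the other
  part.\<close>

definition cap_poly :: "('v::finite \<Rightarrow> nat) \<Rightarrow> 'v set \<Rightarrow> nat \<Rightarrow> (real ^ 'v) set" where
  "cap_poly c T k =
    {x. (\<forall>i. 0 \<le> x $ i \<and> x $ i \<le> real (c i)) \<and> (\<Sum>i\<in>T. x $ i) \<le> real k}"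

lemma sum_eq_inner_indicator:
  "(\<Sum>i\<in>T. x $ i) = (\<chi> i. if i \<in> T then 1 else 0) \<bullet> (x :: real ^ 'v::finite)"
  by (simp add: inner_vec_def if_distrib[of "\<lambda>t. t * _"] sum.If_cases)

lemma cap_poly_eq_cbox_Int_halfspace:
  "cap_poly c T k = cbox 0 (natvec c) \<inter> {x. (\<chi> i. if i \<in> T then 1 else 0) \<bullet> x \<le> real k}"
  by (auto simp: cap_poly_def mem_box_cart sum_eq_inner_indicator)

lemma not_extreme_point_perturb:
  assumes "v \<noteq> 0" "x + v \<in> S" "x - v \<in> S"
  shows "\<not> x extreme_point_of S"
proof -
  have "x \<in> open_segment (x + v) (x - v)"
    unfolding in_segment
  proof (intro conjI exI[of _ "1/2"])
    have "x = (1/2 + 1/2 :: real) *\<^sub>R x" by simp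
    then show "x = (1 - 1/2) *\<^sub>R (x + v) + (1/2 :: real) *\<^sub>R (x - v)"
      by (simp add: algebra_simps flip: scaleR_add_left)
    show "x + v \<noteq> x - v"
    proof
      assume "x + v = x - v"
      then have "2 *\<^sub>R v = 0" by (simp add: scaleR_2 algebra_simps)
      then show False using \<open>v \<noteq> 0\<close> by simp
    qed
  qed auto
  then show ?thesis using assms by (auto simp: extreme_point_of_def)
qed

lemma sum_axis: "finite T \<Longrightarrow> (\<Sum>i\<in>T. axis j t $ i) = (if j \<in> T then t else 0)"
  by (simp add: axis_def)

text \<open>A point with a fractional coordinate can be moved a little both ways inside the
  polytope. The direction depends on where the fractional coordinates lie.\<close>

lemma cap_poly_extreme_point_integral:
  assumes x: "x extreme_point_of cap_poly c T k"
  shows "x $ i \<in> \<int>"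
proof -
  have xP: "x \<in> cap_poly c T k" using x by (simp add: extreme_point_of_def)
  then have bnd: "0 \<le> x $ j" "x $ j \<le> real (c j)" and capx: "(\<Sum>i\<in>T. x $ i) \<le> real k" for j
    by (auto simp: cap_poly_def)
  have strict: "0 < x $ j" "x $ j < real (c j)" if "x $ j \<notin> \<int>" for j
    using bnd[of j] that by (metis Ints_0 Ints_of_nat order_le_less)+
  \<comment> \<open>A coordinate outside \<open>T\<close> does not enter the cap and can be moved
    alone.\<close>
  have outside: "x $ j \<in> \<int>" if "j \<notin> T" for j
  proof (rule ccontr)
    assume j: "x $ j \<notin> \<int>"
    define \<epsilon> where "\<epsilon> = min (x $ j) (real (c j) - x $ j)"
    have \<epsilon>: "0 < \<epsilon>" "\<epsilon> \<le> x $ j" "\<epsilon> \<le> real (c j) - x $ j"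
      using strict[OF j] by (auto simp: \<epsilon>_def)
    have "x + axis j \<epsilon> \<in> cap_poly c T k" "x - axis j \<epsilon> \<in> cap_poly c T k"
      using bnd capx \<epsilon> that
      by (auto simp: cap_poly_def sum.distrib sum_subtractf sum_axis) (auto simp: axis_def)
    then show False using x \<epsilon> not_extreme_point_perturb[of "axis j \<epsilon>" x] by (auto simp: axis_eq_0_iff)
  qed
  \<comment> \<open>Two fractional coordinates in \<open>T\<close> are moved in opposite directions,
    which preserves the sum over \<open>T\<close>.\<close>
  have two: "j = j'" if jj: "j \<in> T" "j' \<in> T" "x $ j \<notin> \<int>" "x $ j' \<notin> \<int>" for j j'
  proof (rule ccontr)
    assume ne: "j \<noteq> j'"
    define \<epsilon> where "\<epsilon> = min (min (x $ j) (real (c j) - x $ j)) (min (x $ j') (real (c j') - x $ j'))"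
    have \<epsilon>: "0 < \<epsilon>" "\<epsilon> \<le> x $ j" "\<epsilon> \<le> real (c j) - x $ j" "\<epsilon> \<le> x $ j'" "\<epsilon> \<le> real (c j') - x $ j'"
      using strict[OF jj(3)] strict[OF jj(4)] by (auto simp: \<epsilon>_def)
    let ?v = "axis j \<epsilon> - axis j' \<epsilon>"
    have "x + ?v \<in> cap_poly c T k" "x - ?v \<in> cap_poly c T k"
      using bnd capx \<epsilon> ne jj
      by (auto simp: cap_poly_def sum.distrib sum_subtractf sum_axis) (auto simp: axis_def)
    moreover have "?v \<noteq> 0" using \<epsilon>(1) ne by (simp add: axis_eq_axis)
    ultimately show False using x not_extreme_point_perturb[of ?v x] by auto
  qed
  show ?thesis
  proof (rule ccontr)
    assume i: "x $ i \<notin> \<int>"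
    then have iT: "i \<in> T" using outside by blast
    \<comment> \<open>With a single fractional coordinate in \<open>T\<close> the sum over
      \<open>T\<close> is not an integer. Since \<open>k\<close> is one, the cap is strict and
      leaves room to move that coordinate alone.\<close>
    have "(\<Sum>j\<in>T - {i}. x $ j) \<in> \<int>" using two[OF iT _ i] by (auto intro!: Ints_sum)
    moreover have sum_eq: "(\<Sum>j\<in>T. x $ j) = x $ i + (\<Sum>j\<in>T - {i}. x $ j)"
      using iT by (simp add: sum.remove)
    ultimately have "(\<Sum>j\<in>T. x $ j) \<notin> \<int>" using i
      by (metis Ints_diff add_diff_cancel_right')
    then have capx': "(\<Sum>j\<in>T. x $ j) < real k"
      using capx by (metis Ints_of_nat order_le_less)
    define \<epsilon> where "\<epsilon> = min (min (x $ i) (real (c i) - x $ i)) (real k - (\<Sum>j\<in>T. x $ j))"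
    have \<epsilon>: "0 < \<epsilon>" "\<epsilon> \<le> x $ i" "\<epsilon> \<le> real (c i) - x $ i" "\<epsilon> \<le> real k - (\<Sum>j\<in>T. x $ j)"
      using strict[OF i] capx' by (auto simp: \<epsilon>_def)
    have "x + axis i \<epsilon> \<in> cap_poly c T k" "x - axis i \<epsilon> \<in> cap_poly c T k"
      using bnd capx \<epsilon> iT
      by (auto simp: cap_poly_def sum.distrib sum_subtractf sum_axis) (auto simp: axis_def)
    then show False using x \<epsilon> not_extreme_point_perturb[of "axis i \<epsilon>" x] by (auto simp: axis_eq_0_iff)
  qed
qed

text \<open>By Krein-Milman the polytope is the hull of its extreme points. These are integral and
  nonnegative, so they are natural vectors satisfying the same inequalities.\<close>

lemma cap_poly_eq_convex_hull:
  "cap_poly c T k = convex hull (natvec ` {a. (\<forall>i. a i \<le> c i) \<and> sum a T \<le> k})"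
    (is "?P = convex hull ?D")
proof
  have "convex ?P" "compact ?P" unfolding cap_poly_eq_cbox_Int_halfspace
    by (auto intro!: convex_Int convex_box convex_halfspace_le compact_Int_closed closed_halfspace_le)
  then have "?P = convex hull {x. x extreme_point_of ?P}"
    by (rule Krein_Milman_Minkowski[rotated])
  also have "\<dots> \<subseteq> convex hull ?D"
  proof (intro hull_mono subsetI, drule CollectD)
    fix x assume x: "x extreme_point_of ?P"
    define a where "a i = nat \<lfloor>x $ i\<rfloor>" for i
    have xP: "x \<in> ?P" using x by (simp add: extreme_point_of_def)
    then have a: "x $ i = real (a i)" for i
      using cap_poly_extreme_point_integral[OF x, of i] by (auto simp: a_def cap_poly_def)
    then have "x = natvec a" by (simp add: vec_eq_iff)
    moreover have "(\<forall>i. a i \<le> c i) \<and> sum a T \<le> k"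
      using xP by (simp add: cap_poly_def a flip: of_nat_sum)
    ultimately show "x \<in> ?D" by blast
  qed
  finally show "?P \<subseteq> convex hull ?D" .
  show "convex hull ?D \<subseteq> ?P"
    using \<open>convex ?P\<close> by (intro hull_minimal) (auto simp: cap_poly_def simp flip: of_nat_sum)
qed

lemma finite_bounded_functions: "finite {a :: 'v::finite \<Rightarrow> nat. (\<forall>i. a i \<le> c i) \<and> Q a}"
proof (rule finite_subset)
  show "{a. (\<forall>i. a i \<le> c i) \<and> Q a} \<subseteq> Pi\<^sub>E UNIV (\<lambda>i. {..c i})" by (auto simp: PiE_iff)
qed (simp add: finite_PiE)

lemma lattice_polytope_convex_hull:
  assumes "finite S" "\<And>x i. x \<in> S \<Longrightarrow> x $ i \<in> \<int>"
  shows "lattice_polytope (convex hull S)"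
  using assms extreme_point_of_convex_hull unfolding lattice_polytope_def polytope_def by blast

lemma lattice_polytope_cap_poly: "lattice_polytope (cap_poly c T k)"
  unfolding cap_poly_eq_convex_hull
  by (rule lattice_polytope_convex_hull) (auto simp: finite_bounded_functions)

lemma lattice_polytope_affine_cap_poly:
  fixes a :: "int ^ 'v::finite"
  shows "lattice_polytope ((\<lambda>x. real d *\<^sub>R x - (\<chi> i. real_of_int (a $ i))) ` cap_poly c T k)"
proof -
  let ?f = "\<lambda>x. - (\<chi> i. real_of_int (a $ i)) + real d *\<^sub>R x"
  let ?D = "natvec ` {b. (\<forall>i. b i \<le> c i) \<and> sum b T \<le> k}"
  have "(\<lambda>x. real d *\<^sub>R x - (\<chi> i. real_of_int (a $ i))) ` cap_poly c T k = convex hull (?f ` ?D)"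
    unfolding cap_poly_eq_convex_hull convex_hull_affinity by simp
  moreover have "lattice_polytope (convex hull (?f ` ?D))"
    by (rule lattice_polytope_convex_hull) (auto simp: finite_bounded_functions)
  ultimately show ?thesis by simp
qed

subsection \<open>Reflexive and Gorenstein polytopes\<close>

lemma mem_dual_polytope_iff: "x \<in> dual_polytope P \<longleftrightarrow> (\<forall>y\<in>P. x \<bullet> y \<le> 1)"
  by (simp add: dual_polytope_def inner_vec_def)

text \<open>A facet with primitive normal \<open>u\<close> yields the vertex \<open>u / B\<close> of the dual, \<open>B\<close> being the
  lattice distance of the facet from the origin. Integrality of that vertex forces \<open>B = 1\<close>.\<close>

lemma reflexive_facet_distance:
  fixes a :: "int ^ 'v::finite" and u p :: "real ^ 'v"
  defines "A \<equiv> \<chi> i. real_of_int (a $ i)"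
  assumes refl: "reflexive_polytope ((\<lambda>x. real d *\<^sub>R x - A) ` P)" and d: "0 < d"
    and u: "\<And>i. u $ i \<in> \<int>" "\<bar>u $ i\<bar> = 1"
    and le: "\<And>y. y \<in> P \<Longrightarrow> u \<bullet> y \<le> real b"
    and p: "p \<in> P" "u \<bullet> p = real b"
    and span: "\<And>v \<beta>. (\<And>y. y \<in> P \<Longrightarrow> u \<bullet> y = real b \<Longrightarrow> v \<bullet> y = \<beta>) \<Longrightarrow> \<exists>t. v = t *\<^sub>R u"
  shows "real d * real b - u \<bullet> A = 1"
proof -
  let ?f = "\<lambda>x. real d *\<^sub>R x - A"
  define B where "B = real d * real b - u \<bullet> A"
  have BZ: "B \<in> \<int>"
    unfolding B_def A_def inner_vec_def using u(1) by (auto intro!: Ints_diff Ints_sum Ints_mult)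
  have u0: "u \<noteq> 0" using u(2) by auto
  have leB: "u \<bullet> ?f y \<le> B" if "y \<in> P" for y
    using le[OF that] d by (simp add: B_def inner_diff_right)
  have eqB: "u \<bullet> ?f y = B" if "u \<bullet> y = real b" for y
    using that by (simp add: B_def inner_diff_right)
  \<comment> \<open>A small positive multiple of \<open>u\<close> lies in the polytope around the
    origin, which forces \<open>B > 0\<close>.\<close>
  have "0 \<in> interior (?f ` P)" using refl by (simp add: reflexive_polytope_def)
  then obtain \<epsilon> where \<epsilon>: "0 < \<epsilon>" "ball 0 \<epsilon> \<subseteq> ?f ` P" by (auto simp: mem_interior)
  have "(\<epsilon> / (2 * norm u)) *\<^sub>R u \<in> ball 0 \<epsilon>" using \<epsilon>(1) u0 by simp
  then obtain y where y: "y \<in> P" "(\<epsilon> / (2 * norm u)) *\<^sub>R u = ?f y" using \<epsilon>(2) by blast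
  have "0 < u \<bullet> ((\<epsilon> / (2 * norm u)) *\<^sub>R u)" using \<epsilon>(1) u0 by simp
  then have B: "0 < B" using leB[OF y(1)] y(2) by simp
  define w where "w = (1 / B) *\<^sub>R u"
  have dual: "x \<in> dual_polytope (?f ` P) \<longleftrightarrow> (\<forall>y\<in>P. x \<bullet> ?f y \<le> 1)" for x
    by (simp add: mem_dual_polytope_iff)
  \<comment> \<open>The facet spans a hyperplane that misses the origin, so only one functional is
    constantly 1 on it.\<close>
  have uniq: "v = w" if v: "\<And>y. y \<in> P \<Longrightarrow> u \<bullet> y = real b \<Longrightarrow> v \<bullet> ?f y = 1" for v
  proof -
    have "v \<bullet> y = (1 + v \<bullet> A) / real d" if "y \<in> P" "u \<bullet> y = real b" for y
      using v[OF that] d by (simp add: inner_diff_right field_simps)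
    then obtain t where t: "v = t *\<^sub>R u" using span by blast
    have "t * B = 1" using v[OF p] eqB[OF p(2)] t by simp
    then show ?thesis using B t by (simp add: w_def field_simps)
  qed
  \<comment> \<open>Endpoints of a segment through \<open>w\<close> in the dual are at most 1 on the
    facet and average to 1 there. So they equal 1 on the facet and coincide with
    \<open>w\<close>.\<close>
  have "w extreme_point_of dual_polytope (?f ` P)"
    unfolding extreme_point_of_def
  proof (intro conjI ballI notI)
    show "w \<in> dual_polytope (?f ` P)"
      unfolding dual using leB B by (simp add: w_def)
    fix v1 v2
    assume v: "v1 \<in> dual_polytope (?f ` P)" "v2 \<in> dual_polytope (?f ` P)"
      and seg: "w \<in> open_segment v1 v2"
    obtain t where t: "0 < t" "t < 1" "w = (1 - t) *\<^sub>R v1 + t *\<^sub>R v2"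
      using seg by (auto simp: in_segment)
    have "v1 = w"
    proof (rule uniq)
      fix y assume y: "y \<in> P" "u \<bullet> y = real b"
      have v12: "v1 \<bullet> ?f y \<le> 1" "v2 \<bullet> ?f y \<le> 1" using v y(1) unfolding dual by blast+
      have "1 = w \<bullet> ?f y" using eqB[OF y(2)] B by (simp add: w_def)
      also have "\<dots> = (1 - t) * (v1 \<bullet> ?f y) + t * (v2 \<bullet> ?f y)"
        unfolding t(3) by (simp add: inner_add_left)
      also have "\<dots> \<le> (1 - t) * (v1 \<bullet> ?f y) + t"
        using v12(2) t(1) by simp
      finally have "(1 - t) * 1 \<le> (1 - t) * (v1 \<bullet> ?f y)" by simp
      then have "1 \<le> v1 \<bullet> ?f y" using t(2) by (simp only: mult_le_cancel_left_pos)
      then show "v1 \<bullet> ?f y = 1" using v12(1) by simp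
    qed
    then show False using seg by (simp add: open_segment_def)
  qed
  \<comment> \<open>At the fixed index \<open>i\<close> with \<open>u $ i\<close> equal to 1 or -1,
    integrality of \<open>w\<close> makes \<open>1 / B\<close> a positive integer. As
    \<open>B\<close> is one too, \<open>B = 1\<close>.\<close>
  then have "w $ i \<in> \<int>" using refl by (auto simp: reflexive_polytope_def lattice_polytope_def)
  then have "\<bar>w $ i\<bar> \<in> \<int>" by simp
  then have "1 / B \<in> \<int>" using u(2) B by (simp add: w_def abs_mult)
  then obtain z where z: "1 / B = of_int z" by (elim Ints_cases)
  then have "0 < z" using B by (metis of_int_0_less_iff zero_less_divide_1_iff)
  then have "1 \<le> 1 / B" unfolding z by simp
  moreover have "1 \<le> B" using B BZ by (auto elim!: Ints_cases)
  ultimately show ?thesis using B by (simp add: B_def field_simps)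
qed

text \<open>By polar duality, the dual of a polyhedron \<open>{y. \<forall>u\<in>U. u \<bullet> y \<le> 1}\<close> is the convex hull
  of \<open>U\<close> as soon as that hull contains the origin.\<close>

lemma reflexive_polytopeI:
  fixes Q U :: "(real ^ 'v::finite) set"
  assumes "lattice_polytope Q" "finite U" "\<And>u i. u \<in> U \<Longrightarrow> u $ i \<in> \<int>"
    and Q: "Q = {y. \<forall>u\<in>U. u \<bullet> y \<le> 1}" and zero: "0 \<in> convex hull U"
  shows "reflexive_polytope Q"
proof -
  have "open (\<Inter>u\<in>U. {y. u \<bullet> y < 1})" using \<open>finite U\<close> by (intro open_INT) (auto simp: open_halfspace_lt)
  then have int: "0 \<in> interior Q" by (rule interiorI) (auto simp: Q intro: less_imp_le)
  then have "aff_dim Q = int CARD('v)" using aff_dim_nonempty_interior[of Q] by auto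
  have "dual_polytope Q = convex hull U"
  proof
    have "dual_polytope Q = (\<Inter>y\<in>Q. {x. y \<bullet> x \<le> 1})"
      by (auto simp: mem_dual_polytope_iff inner_commute)
    then have "convex (dual_polytope Q)" by (auto intro: convex_INT convex_halfspace_le)
    then show "convex hull U \<subseteq> dual_polytope Q"
      by (rule hull_minimal[rotated]) (auto simp: mem_dual_polytope_iff Q)
    show "dual_polytope Q \<subseteq> convex hull U"
    proof
      fix z assume z: "z \<in> dual_polytope Q"
      show "z \<in> convex hull U"
      proof (rule ccontr)
        assume "z \<notin> convex hull U"
        \<comment> \<open>Since 0 lies in the hull, \<open>b < 0\<close>. Dividing by
          \<open>b\<close> reverses the inequalities: \<open>a / b\<close> lies in \<open>Q\<close>,
          but its product with \<open>z\<close> exceeds 1.\<close>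
        then obtain a b where ab: "a \<bullet> z < b" "\<forall>x\<in>convex hull U. b < a \<bullet> x"
          using separating_hyperplane_closed_point[of "convex hull U" z] \<open>finite U\<close>
          by (auto simp: compact_imp_closed finite_imp_compact_convex_hull)
        then have b: "b < 0" using zero by auto
        have "u \<bullet> ((1 / b) *\<^sub>R a) \<le> 1" if "u \<in> U" for u
          using ab(2) hull_inc[OF that] b by (force simp: divide_le_eq inner_commute)
        then have "(1 / b) *\<^sub>R a \<in> Q" by (simp add: Q)
        then have "z \<bullet> ((1 / b) *\<^sub>R a) \<le> 1" using z unfolding mem_dual_polytope_iff by blast
        then show False using ab(1) b by (simp add: divide_le_eq inner_commute)
      qed
    qed
  qed
  then have "lattice_polytope (dual_polytope Q)"
    using assms(2,3) by (simp add: lattice_polytope_convex_hull)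
  then show ?thesis using assms(1) int \<open>aff_dim Q = int CARD('v)\<close> by (simp add: reflexive_polytope_def)
qed

text \<open>Dilation by \<open>d > 0\<close> and translation preserve the affine dimension, so full
  dimension passes from the reflexive image back to \<open>P\<close>.\<close>

lemma gorenstein_polytopeI:
  assumes P: "lattice_polytope P" "0 < d"
    and refl: "reflexive_polytope ((\<lambda>x. real d *\<^sub>R x - (\<chi> i. real_of_int (a $ i))) ` P)"
  shows "gorenstein_polytope P"
proof -
  let ?A = "\<chi> i. real_of_int (a $ i)"
  have "(\<lambda>x. real d *\<^sub>R x - ?A) ` P = (+) (- ?A) ` ((*\<^sub>R) (real d) ` P)" by (simp add: image_image)
  moreover have "aff_dim ((*\<^sub>R) (real d) ` P) = aff_dim P"
    using \<open>0 < d\<close> by (intro aff_dim_injective_linear_image linear_scaleR) (auto intro: injI)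
  ultimately have "aff_dim ((\<lambda>x. real d *\<^sub>R x - ?A) ` P) = aff_dim P"
    by (simp only: aff_dim_translation_eq)
  then show ?thesis using assms by (auto simp: gorenstein_polytope_def reflexive_polytope_def)
qed

section \<open>Classification of the Gorenstein cut boxes\<close>

lemma gorenstein_cap_poly_facets:
  fixes c :: "'v::finite \<Rightarrow> nat"
  assumes gor: "gorenstein_polytope (cap_poly c T k)"
    and c: "\<And>i. 0 < c i" and k: "0 < k" "k \<le> sum c T"
  obtains d where "0 < d" "\<And>i. i \<notin> T \<or> c i < k \<or> k = sum c T \<Longrightarrow> d * c i = 2"
    "k < sum c T \<Longrightarrow> d * k = card T + 1"
proof -
  let ?P = "cap_poly c T k"
  obtain d and a :: "int ^ 'v" where d: "0 < d"
    and refl: "reflexive_polytope ((\<lambda>x. real d *\<^sub>R x - (\<chi> i. real_of_int (a $ i))) ` ?P)"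
    using gor by (auto simp: gorenstein_polytope_def)
  let ?A = "\<chi> i. real_of_int (a $ i)"
  have axis_span: "\<exists>t. v = t *\<^sub>R axis i 1" if "\<And>j. j \<noteq> i \<Longrightarrow> v $ j = 0" for v :: "real ^ 'v" and i
    using that by (intro exI[of _ "v $ i"]) (auto simp: vec_eq_iff axis_def)
  \<comment> \<open>The facet \<open>x $ i = 0\<close> contains the origin and all other unit
    vectors. Its distance from the translated origin is \<open>?A $ i\<close>.\<close>
  have A: "?A $ i = 1" for i
  proof -
    have "real d * real 0 - (- axis i 1) \<bullet> ?A = 1"
    proof (rule reflexive_facet_distance[OF refl d, of "- axis i 1" i 0 0])
      show "0 \<in> ?P" by (simp add: cap_poly_def)
      fix v \<beta>
      assume v: "\<And>y. y \<in> ?P \<Longrightarrow> (- axis i 1) \<bullet> y = real 0 \<Longrightarrow> v \<bullet> y = \<beta>"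
      have "\<beta> = 0" using v[of 0] by (simp add: cap_poly_def)
      have "v $ j = 0" if "j \<noteq> i" for j
      proof -
        have "axis j 1 \<in> ?P" using c k by (auto simp: cap_poly_def sum_axis) (auto simp: axis_def Suc_le_eq)
        then have "v \<bullet> axis j 1 = \<beta>" using that by (intro v) (auto simp: inner_axis_axis)
        then show ?thesis using \<open>\<beta> = 0\<close> by (simp add: inner_axis)
      qed
      then obtain t where "v = t *\<^sub>R axis i 1" using axis_span by blast
      then show "\<exists>t. v = t *\<^sub>R (- axis i 1)" by (intro exI[of _ "- t"]) simp
    qed (auto simp: cap_poly_def inner_axis', auto simp: axis_def)
    then show ?thesis by (simp add: inner_axis')
  qed
  \<comment> \<open>The condition on \<open>i\<close> ensures that the bound \<open>c i\<close>
    defines a facet, not one hidden by the cap. With \<open>?A $ i = 1\<close>, distance 1 reads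
    \<open>d * c i - 1 = 1\<close>.\<close>
  have upper: "d * c i = 2" if i: "i \<notin> T \<or> c i < k \<or> k = sum c T" for i
  proof -
    have one: "c i \<le> k" if "i \<in> T" using i that by (auto intro: member_le_sum)
    \<comment> \<open>The cap must leave room for one more unit in \<open>T\<close> beyond
      \<open>c i\<close>, so that the points \<open>c i\<close> on axis \<open>i\<close> plus a unit
      vector \<open>j\<close> span the facet. If \<open>k = sum c T\<close>, the room is
      \<open>c j\<close>.\<close>
    have two: "c i + 1 \<le> k" if "i \<in> T" "j \<in> T" "j \<noteq> i" for j
    proof (cases "k = sum c T")
      case True
      have "sum c {i, j} \<le> sum c T" using that by (intro sum_mono2) auto
      then show ?thesis using True c[of j] \<open>j \<noteq> i\<close> by simp
    qed (use i that in auto)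
    have mem: "axis i (real (c i)) + axis j 1 \<in> ?P" if "j \<noteq> i" for j
    proof -
      have "real (c i) + 1 \<le> real k" if "i \<in> T" "j \<in> T"
        using two[OF that \<open>j \<noteq> i\<close>] by linarith
      then have "(\<Sum>l\<in>T. (axis i (real (c i)) + axis j 1) $ l) \<le> real k"
        using one k by (auto simp: sum.distrib sum_axis)
      moreover have "0 \<le> (axis i (real (c i)) + axis j 1) $ l \<and>
          (axis i (real (c i)) + axis j 1) $ l \<le> real (c l)" for l
        using \<open>j \<noteq> i\<close> c[of l] by (auto simp: axis_def)
      ultimately show ?thesis by (simp add: cap_poly_def)
    qed
    have mem0: "axis i (real (c i)) \<in> ?P"
      using one k by (auto simp: cap_poly_def sum_axis) (auto simp: axis_def)
    have "real d * real (c i) - axis i 1 \<bullet> ?A = 1"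
    proof (rule reflexive_facet_distance[OF refl d, of "axis i 1" i "c i" "axis i (real (c i))"])
      fix v \<beta>
      assume v: "\<And>y. y \<in> ?P \<Longrightarrow> axis i 1 \<bullet> y = real (c i) \<Longrightarrow> v \<bullet> y = \<beta>"
      have "v $ j = 0" if "j \<noteq> i" for j
        using v[OF mem0] v[OF mem[OF that]] that
        by (simp add: inner_add_right inner_axis_axis) (simp add: inner_axis)
      then show "\<exists>t. v = t *\<^sub>R axis i 1" by (rule axis_span)
    qed (use mem0 in \<open>auto simp: inner_axis_axis cap_poly_def inner_axis'\<close>, auto simp: axis_def)
    then have "real (d * c i) = real 2" using A[of i] by (simp add: inner_axis')
    then show ?thesis by (simp only: of_nat_eq_iff)
  qed
  have cap: "d * k = card T + 1" if less: "k < sum c T"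
  proof -
    let ?u = "\<chi> i. if i \<in> T then 1 else 0 :: real ^ 'v"
    \<comment> \<open>\<open>c\<close> restricted to \<open>T\<close> and scaled so that the cap is
      tight. The ratio is below 1, so on \<open>T\<close> the point is strictly between the bounds
      and can be perturbed along the facet.\<close>
    define p :: "real ^ 'v" where
      "p = (\<chi> i. if i \<in> T then real (c i) * (real k / real (sum c T)) else 0)"
    have r: "0 < real k / real (sum c T)" "real k / real (sum c T) < 1"
      using k(1) less by (simp_all del: of_nat_sum)
    have pT: "0 < p $ i" "p $ i < real (c i)" if "i \<in> T" for i
      using that mult_pos_pos[OF _ r(1), of "real (c i)"] c[of i]
        mult_strict_left_mono[OF r(2), of "real (c i)"] by (simp_all add: p_def del: of_nat_sum)
    have p0: "p $ i = 0" if "i \<notin> T" for i using that by (simp add: p_def)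
    have "(\<Sum>i\<in>T. p $ i) = real (sum c T) * (real k / real (sum c T))"
      by (simp add: p_def sum_distrib_right sum_divide_distrib)
    then have p_sum: "(\<Sum>i\<in>T. p $ i) = real k" using less by (auto simp del: of_nat_sum sum_eq_0_iff)
    have u_eq: "?u \<bullet> y = (\<Sum>i\<in>T. y $ i)" for y :: "real ^ 'v"
      by (simp add: sum_eq_inner_indicator)
    obtain i0 where i0: "i0 \<in> T" using less by fastforce
    have p_bd: "0 \<le> p $ l" "p $ l \<le> real (c l)" for l
      using pT[of l] p0[of l] by (cases "l \<in> T"; simp)+
    have pP: "p \<in> ?P" using p_bd p_sum by (auto simp: cap_poly_def)
    have "real d * real k - ?u \<bullet> ?A = 1"
    proof (rule reflexive_facet_distance[OF refl d, of ?u i0 k p])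
      fix v \<beta>
      assume v: "\<And>y. y \<in> ?P \<Longrightarrow> ?u \<bullet> y = real k \<Longrightarrow> v \<bullet> y = \<beta>"
      have vp: "v \<bullet> p = \<beta>" using pP p_sum by (intro v) (auto simp: u_eq)
      have out: "v $ j = 0" if "j \<notin> T" for j
      proof -
        have "p + axis j 1 \<in> ?P"
          using p_bd p0[OF that] p_sum c[of j] that
          by (auto simp: cap_poly_def sum.distrib sum_axis) (auto simp: axis_def)
        then have "v \<bullet> (p + axis j 1) = \<beta>"
          using that p_sum by (intro v) (auto simp: u_eq sum.distrib sum_axis)
        then show ?thesis using vp by (simp add: inner_add_right inner_axis)
      qed
      \<comment> \<open>Shifting weight from \<open>i0\<close> to \<open>j\<close> keeps the cap
        tight, so \<open>v\<close> cannot distinguish coordinates in \<open>T\<close>.\<close>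
      have eq: "v $ j = v $ i0" if "j \<in> T" for j
      proof (cases "j = i0")
        case False
        define \<epsilon> where "\<epsilon> = min (real (c j) - p $ j) (p $ i0)"
        have \<epsilon>: "0 < \<epsilon>" "\<epsilon> \<le> real (c j) - p $ j" "\<epsilon> \<le> p $ i0"
          using pT[OF that] pT[OF i0] by (auto simp: \<epsilon>_def)
        have "p + (axis j \<epsilon> - axis i0 \<epsilon>) \<in> ?P"
          using p_bd p_sum \<epsilon> that i0 False
          by (auto simp: cap_poly_def sum.distrib sum_subtractf sum_axis)
            (auto simp: axis_def intro: order_trans[OF _ p_bd(2)])
        then have "v \<bullet> (p + (axis j \<epsilon> - axis i0 \<epsilon>)) = \<beta>"
          using that i0 p_sum by (intro v) (auto simp: u_eq sum.distrib sum_subtractf sum_axis)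
        then show ?thesis using vp \<epsilon>(1) by (simp add: inner_add_right inner_diff_right inner_axis)
      qed simp
      show "\<exists>t. v = t *\<^sub>R ?u"
        using out eq by (intro exI[of _ "v $ i0"]) (auto simp: vec_eq_iff)
    next
      fix y assume "y \<in> ?P"
      then show "?u \<bullet> y \<le> real k" by (simp add: u_eq cap_poly_def)
    qed (use i0 pP p_sum in \<open>auto simp: u_eq\<close>)
    moreover have "?u \<bullet> ?A = real (card T)" using A by (simp add: u_eq)
    ultimately have "real (d * k) = real (card T + 1)" by simp
    then show ?thesis by (simp only: of_nat_eq_iff)
  qed
  show ?thesis using that[OF d upper cap] .
qed

text \<open>The listed polytopes when \<open>T\<close> is the part carrying the extra inequality and \<open>- T\<close> is the
  other part.\<close>

definition listed_at :: "'v::finite set \<Rightarrow> (real ^ 'v) set set" where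
  "listed_at T = {P. \<exists>e\<in>{1, 2::nat}.
     card T = card (- T) \<and> P = {x. \<forall>i. 0 \<le> x $ i \<and> x $ i \<le> real e} \<or>
     (\<exists>A\<subseteq>T. 2 \<le> card (- T) \<and> card T = 2 * card (- T) - 1 \<and>
       P = {x. (\<forall>i. 0 \<le> x $ i) \<and> (\<forall>i. i \<notin> A \<longrightarrow> x $ i \<le> real e) \<and>
               (\<Sum>i\<in>T. x $ i) \<le> real (e * card (- T))})}"

lemma listed_atE:
  assumes "P \<in> listed_at T"
  obtains (box) e where "e \<in> {1, 2::nat}" "card T = card (- T)"
      "P = {x. \<forall>i. 0 \<le> x $ i \<and> x $ i \<le> real e}"
  | (cap) e A where "e \<in> {1, 2::nat}" "A \<subseteq> T" "2 \<le> card (- T)" "card T = 2 * card (- T) - 1"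
      "P = {x. (\<forall>i. 0 \<le> x $ i) \<and> (\<forall>i. i \<notin> A \<longrightarrow> x $ i \<le> real e) \<and>
               (\<Sum>i\<in>T. x $ i) \<le> real (e * card (- T))}"
  using assms unfolding listed_at_def by (elim CollectE bexE disjE exE conjE) (rule that; assumption)+

lemma cap_poly_const_eq_box:
  assumes "e * card T \<le> k"
  shows "cap_poly (\<lambda>_. e) T k = {x. \<forall>i. 0 \<le> x $ i \<and> x $ i \<le> real e}"
proof -
  have "(\<Sum>i\<in>T. x $ i) \<le> real k" if "\<forall>i. x $ i \<le> real e" for x :: "real ^ 'a"
  proof -
    have "(\<Sum>i\<in>T. x $ i) \<le> real (card T) * real e" using that by (intro sum_bounded_above) auto
    also have "\<dots> \<le> real k" using assms by (simp add: mult.commute flip: of_nat_mult)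
    finally show ?thesis .
  qed
  then show ?thesis by (auto simp: cap_poly_def)
qed

text \<open>Coordinates are nonnegative, so each one in \<open>T\<close> is at most the sum over
  \<open>T\<close>, hence at most \<open>k\<close>. Bounds of at least \<open>k\<close> are implied
  by the cap.\<close>

lemma cap_poly_drop_bounds:
  assumes "A \<subseteq> T" "\<And>i. i \<notin> A \<Longrightarrow> c i = e" "\<And>i. i \<in> A \<Longrightarrow> k \<le> c i"
  shows "cap_poly c T k = {x. (\<forall>i. 0 \<le> x $ i) \<and> (\<forall>i. i \<notin> A \<longrightarrow> x $ i \<le> real e) \<and>
    (\<Sum>i\<in>T. x $ i) \<le> real k}"
proof -
  have "x $ i \<le> real (c i)" if x: "\<forall>i. 0 \<le> x $ i" "(\<Sum>i\<in>T. x $ i) \<le> real k" and "i \<in> A"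
    for x :: "real ^ 'a" and i
  proof -
    have "x $ i \<le> (\<Sum>i\<in>T. x $ i)" using \<open>i \<in> A\<close> assms(1) x(1) by (intro member_le_sum) auto
    also have "\<dots> \<le> real (c i)" using x(2) assms(3)[OF \<open>i \<in> A\<close>] by simp
    finally show ?thesis .
  qed
  then show ?thesis using assms(2) by (fastforce simp: cap_poly_def)
qed

lemma gorenstein_cap_poly_listed:
  fixes c :: "'v::finite \<Rightarrow> nat"
  assumes gor: "gorenstein_polytope (cap_poly c T (sum c (- T)))"
    and c: "\<And>i. 0 < c i" and T: "- T \<noteq> {}" "sum c (- T) \<le> sum c T" and card: "3 \<le> CARD('v)"
  shows "cap_poly c T (sum c (- T)) \<in> listed_at T"
proof -
  define k where "k = sum c (- T)"
  have "0 < k" using sum_pos[of "- T" c] c T(1) by (simp add: k_def)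
  then obtain d where d: "0 < d" "\<And>i. i \<notin> T \<or> c i < k \<or> k = sum c T \<Longrightarrow> d * c i = 2"
    "k < sum c T \<Longrightarrow> d * k = card T + 1"
    using gorenstein_cap_poly_facets[OF gor[folded k_def] c _ T(2)[folded k_def]] by blast
  define e where "e = 2 div d"
  \<comment> \<open>A coordinate outside \<open>T\<close> always gives a facet, so \<open>d\<close>
    divides 2 and all bounds tied to facets equal \<open>e = 2 div d\<close>.\<close>
  obtain s where "s \<notin> T" using T(1) by blast
  then have "d dvd 2" using d(2)[of s] by (metis dvd_triv_left)
  then have "d \<le> 2" by (simp add: dvd_imp_le)
  then have "d = 1 \<or> d = 2" using d(1) by linarith
  then have de: "d * e = 2" "e \<in> {1, 2}" by (auto simp: e_def)
  have e: "c i = e" if "i \<notin> T \<or> c i < k \<or> k = sum c T" for i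
    using d(2)[OF that] de(1) d(1) by (metis mult_cancel1 not_gr_zero)
  then have "k = (\<Sum>i\<in>- T. e)" unfolding k_def by (intro sum.cong) auto
  then have k: "k = e * card (- T)" by simp
  have ct: "card T + card (- T) = CARD('v)"
    by (metis Compl_eq_Diff_UNIV card_Diff_subset card_mono finite le_add_diff_inverse subset_UNIV)
  show ?thesis
  proof (cases "k = sum c T")
    case True
    then have ce: "c = (\<lambda>_. e)" using e by auto
    then have "card T = card (- T)" using True k de by auto
    then show ?thesis
      using de(2) cap_poly_const_eq_box[of e T k] unfolding listed_at_def k_def[symmetric]
      by (intro CollectI bexI[of _ e]) (auto simp: ce k)
  next
    case False
    then have "d * k = card T + 1" using d(3) T(2) by (simp add: k_def)
    then have "2 * card (- T) = card T + 1" using de(1) by (metis k mult.assoc)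
    \<comment> \<open>At least 3 vertices rule out the solution with one vertex in each
      part.\<close>
    then have "card T = 2 * card (- T) - 1" "2 \<le> card (- T)" using ct card by linarith+
    \<comment> \<open>Bounds in \<open>T\<close> that differ from \<open>e\<close> define no facet
      and are therefore at least \<open>k\<close>; these indices form the free set.\<close>
    moreover have "cap_poly c T k = {x. (\<forall>i. 0 \<le> x $ i) \<and>
        (\<forall>i. i \<notin> {i\<in>T. c i \<noteq> e} \<longrightarrow> x $ i \<le> real e) \<and> (\<Sum>i\<in>T. x $ i) \<le> real k}"
      by (rule cap_poly_drop_bounds) (use e in \<open>auto simp: not_less[symmetric]\<close>)
    ultimately show ?thesis
      using de(2) unfolding listed_at_def k_def[symmetric]
      by (intro CollectI bexI[of _ e] disjI2 exI[of _ "{i\<in>T. c i \<noteq> e}"]) (auto simp: k)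
  qed
qed

lemma gorenstein_cap_polyI:
  fixes T :: "'v::finite set"
  assumes de: "d * e = 2" and T: "- T \<noteq> {}" and A: "A \<subseteq> T"
    and c: "\<And>i. i \<notin> A \<Longrightarrow> c i = e" "\<And>i. i \<in> A \<Longrightarrow> k \<le> c i"
    and k: "k = e * card (- T)"
    and cases: "card T = card (- T) \<and> A = {} \<or> card T + 1 = 2 * card (- T)"
  shows "gorenstein_polytope (cap_poly c T k)"
proof -
  let ?u = "\<chi> i. if i \<in> T then 1 else 0 :: real ^ 'v"
  let ?f = "\<lambda>x :: real ^ 'v. real d *\<^sub>R x - (\<chi> i. real_of_int ((\<chi> i. 1) $ i))"
  \<comment> \<open>The facet normals after dilating by \<open>d\<close> and translating by the
    all-ones vector. The cap normal is left out for the box, where the bounds imply the cap.\<close>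
  define U where "U = range (\<lambda>i. - axis i 1) \<union> (\<lambda>i. axis i 1) ` (- A) \<union>
    (if A = {} \<and> card T = card (- T) then {} else {?u})"
  have d: "0 < d" using de by (cases d) auto
  have de': "real d * real e = 2" using de by (metis of_nat_mult of_nat_numeral)
  have f_iff: "y \<in> ?f ` S \<longleftrightarrow> (1 / real d) *\<^sub>R (y + 1) \<in> S" for y S
  proof
    assume "y \<in> ?f ` S"
    then obtain x where "x \<in> S" "y = ?f x" by blast
    moreover have "(1 / real d) *\<^sub>R (?f x + 1) = x" using d by (simp add: vec_eq_iff)
    ultimately show "(1 / real d) *\<^sub>R (y + 1) \<in> S" by metis
  next
    assume "(1 / real d) *\<^sub>R (y + 1) \<in> S"
    moreover have "y = ?f ((1 / real d) *\<^sub>R (y + 1))" using d by (simp add: vec_eq_iff)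
    ultimately show "y \<in> ?f ` S" by blast
  qed
  have "reflexive_polytope (?f ` cap_poly c T k)"
  proof (rule reflexive_polytopeI)
    show "lattice_polytope (?f ` cap_poly c T k)" by (rule lattice_polytope_affine_cap_poly)
    show "finite U" by (simp add: U_def)
    show "u $ i \<in> \<int>" if "u \<in> U" for u i using that by (auto simp: U_def axis_def split: if_splits)
    show "0 \<in> convex hull U"
    proof -
      \<comment> \<open>A coordinate outside \<open>T\<close> contributes both a unit vector and its
        negative, whose midpoint is 0.\<close>
      obtain s where "s \<notin> T" using T by blast
      then have "axis s 1 \<in> U" "- axis s 1 \<in> U" using A by (auto simp: U_def)
      then have "(1/2) *\<^sub>R axis s 1 + (1/2) *\<^sub>R (- axis s 1) \<in> convex hull U"
        by (intro convexD[OF convex_convex_hull]) (auto intro: hull_inc)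
      then show ?thesis by simp
    qed
    show "?f ` cap_poly c T k = {y. \<forall>u\<in>U. u \<bullet> y \<le> 1}"
    proof (intro set_eqI)
      fix y :: "real ^ 'v"
      have cap_eq: "cap_poly c T k = {x. (\<forall>i. 0 \<le> x $ i) \<and> (\<forall>i. i \<notin> A \<longrightarrow> x $ i \<le> real e) \<and>
          (\<Sum>i\<in>T. x $ i) \<le> real k}"
        using A c by (rule cap_poly_drop_bounds)
      have U_iff: "(\<forall>u\<in>U. u \<bullet> y \<le> 1) \<longleftrightarrow> (\<forall>i. (- axis i 1) \<bullet> y \<le> 1) \<and>
          (\<forall>i. i \<notin> A \<longrightarrow> axis i 1 \<bullet> y \<le> 1) \<and> (A = {} \<and> card T = card (- T) \<or> ?u \<bullet> y \<le> 1)"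
        unfolding U_def ball_Un by auto
      have 1: "0 \<le> ((1 / real d) *\<^sub>R (y + 1)) $ i \<longleftrightarrow> (- axis i 1) \<bullet> y \<le> 1" for i
        using d by (simp add: inner_axis' zero_le_divide_iff) linarith
      have 2: "((1 / real d) *\<^sub>R (y + 1)) $ i \<le> real e \<longleftrightarrow> axis i 1 \<bullet> y \<le> 1" for i
        using d de' by (auto simp: inner_axis' divide_le_eq mult.commute)
      have "(\<Sum>i\<in>T. ((1 / real d) *\<^sub>R (y + 1)) $ i) = (?u \<bullet> y + real (card T)) / real d"
        by (simp add: sum_divide_distrib[symmetric] sum.distrib sum_eq_inner_indicator[symmetric])
      moreover have "real k * real d = 2 * real (card (- T))" using de' k by (simp add: mult.commute mult.left_commute)
      \<comment> \<open>When \<open>card T + 1 = 2 * card (- T)\<close>, this is exactly the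
        inequality \<open>?u \<bullet> y \<le> 1\<close>.\<close>
      ultimately have 3: "(\<Sum>i\<in>T. ((1 / real d) *\<^sub>R (y + 1)) $ i) \<le> real k \<longleftrightarrow>
          ?u \<bullet> y + real (card T) \<le> 2 * real (card (- T))"
        using d by (simp add: divide_le_eq)
      have 4: "?u \<bullet> y \<le> real (card T)" if "\<forall>i. axis i 1 \<bullet> y \<le> 1"
        using sum_bounded_above[of T "\<lambda>i. y $ i" 1] that
        by (simp add: sum_eq_inner_indicator[symmetric] inner_axis')
      show "y \<in> ?f ` cap_poly c T k \<longleftrightarrow> y \<in> {y. \<forall>u\<in>U. u \<bullet> y \<le> 1}"
        unfolding f_iff cap_eq mem_Collect_eq 1 2 3 U_iff
        using cases 4 by auto
    qed
  qed
  then show ?thesis using d lattice_polytope_cap_poly by (intro gorenstein_polytopeI)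
qed

lemma listed_at_eq:
  fixes T :: "'v::finite set"
  assumes T: "- T \<noteq> {}" and card: "3 \<le> CARD('v)"
  shows "listed_at T = {P. gorenstein_polytope P \<and>
    (\<exists>c. (\<forall>i. 0 < c i) \<and> sum c (- T) \<le> sum c T \<and> P = cap_poly c T (sum c (- T)))}"
proof (intro equalityI subsetI)
  fix P assume "P \<in> listed_at T"
  then have "\<exists>c k. (\<forall>i. 0 < c i) \<and> sum c (- T) \<le> sum c T \<and> sum c (- T) = k \<and>
      P = cap_poly c T k \<and> gorenstein_polytope P"
  proof (cases rule: listed_atE)
    case (box e)
    obtain d where de: "d * e = 2" using box(1) by force
    define k where "k = e * card (- T)"
    have "P = cap_poly (\<lambda>_. e) T k" using box by (simp add: cap_poly_const_eq_box k_def)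
    moreover have "gorenstein_polytope (cap_poly (\<lambda>_. e) T k)"
      by (rule gorenstein_cap_polyI[OF de T, of "{}"]) (auto simp: k_def box)
    ultimately show ?thesis using box by (intro exI[of _ "\<lambda>_. e"] exI[of _ k]) (auto simp: k_def)
  next
    case A: (cap e A)
    obtain d where de: "d * e = 2" using A(1) by force
    define k where "k = e * card (- T)"
    \<comment> \<open>The value \<open>k\<close> on \<open>A\<close> is large enough for the cap to
      imply these bounds.\<close>
    define c where "c i = (if i \<in> A then k else e)" for i
    have "P = cap_poly c T k"
      using cap_poly_drop_bounds[OF A(2), of c e k] by (simp add: c_def A(5) k_def)
    moreover have "gorenstein_polytope (cap_poly c T k)"
      by (rule gorenstein_cap_polyI[OF de T A(2)]) (use A in \<open>auto simp: k_def c_def\<close>)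
    moreover have "0 < c i" for i using A(1,3) by (auto simp: c_def k_def)
    moreover have "sum c (- T) = k"
    proof -
      have "sum c (- T) = (\<Sum>i\<in>- T. e)" using A(2) by (intro sum.cong) (auto simp: c_def)
      then show ?thesis by (simp add: k_def)
    qed
    moreover have "k \<le> sum c T"
    proof -
      have "card (- T) \<le> card T" using A(3,4) by linarith
      then have "k \<le> (\<Sum>i\<in>T. e)" by (simp add: k_def)
      also have "\<dots> \<le> sum c T" using A(3) by (intro sum_mono) (auto simp: c_def k_def)
      finally show ?thesis .
    qed
    ultimately show ?thesis by (intro exI[of _ c] exI[of _ k]) simp
  qed
  then show "P \<in> {P. gorenstein_polytope P \<and>
    (\<exists>c. (\<forall>i. 0 < c i) \<and> sum c (- T) \<le> sum c T \<and> P = cap_poly c T (sum c (- T)))}" by auto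
next
  fix P assume "P \<in> {P. gorenstein_polytope P \<and>
    (\<exists>c. (\<forall>i. 0 < c i) \<and> sum c (- T) \<le> sum c T \<and> P = cap_poly c T (sum c (- T)))}"
  then show "P \<in> listed_at T" using gorenstein_cap_poly_listed[OF _ _ T _ card] by auto
qed

subsection \<open>The two parts of a complete bipartite graph\<close>

lemma Compl_range_Inl: "- range Inl = range Inr"
proof (rule set_eqI)
  show "x \<in> - range Inl \<longleftrightarrow> x \<in> range Inr" for x :: "'a + 'b" by (cases x) auto
qed

lemma Compl_range_Inr: "- range Inr = range Inl"
  by (metis Compl_range_Inl double_complement)

lemma sum_range_Inl: "sum f (range Inl) = (\<Sum>i\<in>UNIV. f (Inl i))"
  by (simp add: sum.reindex)

lemma sum_range_Inr: "sum f (range Inr) = (\<Sum>j\<in>UNIV. f (Inr j))"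
  by (simp add: sum.reindex)

text \<open>The top exponent is \<open>deg_Inl c\<close>, so the degree bound on the left part
  already follows from the box and only the right one remains as a cap.\<close>

lemma conv_D_complete_bipartite_Inr:
  fixes c :: "'m::finite + 'n::finite \<Rightarrow> nat"
  assumes c: "\<And>i. 0 < c i" and le: "deg_Inl c \<le> deg_Inr c"
  shows "conv_D K complete_bipartite c = cap_poly c (range Inr) (deg_Inl c)"
proof -
  have "deg_Inl a \<le> deg_Inl c" if "\<forall>i. a i \<le> c i" for a
    using that by (intro sum_mono) auto
  then have "divisor_vectors K complete_bipartite c
      = {a. (\<forall>i. a i \<le> c i) \<and> sum a (range Inr) \<le> deg_Inl c}"
    using le by (auto simp: divisor_vectors_complete_bipartite[OF c] sum_range_Inr min_absorb1)
  then show ?thesis by (simp add: conv_D_def cap_poly_eq_convex_hull)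
qed

lemma conv_D_complete_bipartite_Inl:
  fixes c :: "'m::finite + 'n::finite \<Rightarrow> nat"
  assumes c: "\<And>i. 0 < c i" and le: "deg_Inr c \<le> deg_Inl c"
  shows "conv_D K complete_bipartite c = cap_poly c (range Inl) (deg_Inr c)"
proof -
  have "deg_Inr a \<le> deg_Inr c" if "\<forall>i. a i \<le> c i" for a
    using that by (intro sum_mono) auto
  then have "divisor_vectors K complete_bipartite c
      = {a. (\<forall>i. a i \<le> c i) \<and> sum a (range Inl) \<le> deg_Inr c}"
    using le by (auto simp: divisor_vectors_complete_bipartite[OF c] sum_range_Inl min_absorb2)
  then show ?thesis by (simp add: conv_D_def cap_poly_eq_convex_hull)
qed

lemma gorenstein_bipartite_polytopes_eq:
  assumes card: "CARD('m::finite) + CARD('n::finite) \<ge> 3"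
  shows "(gorenstein_bipartite_polytopes K :: (real ^ ('m + 'n)) set set)
    = listed_at (range Inr) \<union> listed_at (range Inl)"
proof -
  have card': "3 \<le> CARD('m + 'n)" using card by simp
  have "(\<exists>c. (\<forall>i. 0 < c i) \<and> P = conv_D K complete_bipartite c) \<longleftrightarrow>
      (\<exists>c. (\<forall>i. 0 < c i) \<and> deg_Inl c \<le> deg_Inr c \<and> P = cap_poly c (range Inr) (deg_Inl c)) \<or>
      (\<exists>c. (\<forall>i. 0 < c i) \<and> deg_Inr c \<le> deg_Inl c \<and> P = cap_poly c (range Inl) (deg_Inr c))"
    (is "?L \<longleftrightarrow> ?R") for P :: "(real ^ ('m + 'n)) set"
  proof
    assume ?L
    then obtain c where c: "\<forall>i. 0 < c i" "P = conv_D K complete_bipartite c" by blast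
    show ?R
    proof (cases "deg_Inl c \<le> deg_Inr c")
      case True
      then show ?thesis using c conv_D_complete_bipartite_Inr[of c K] by blast
    next
      case False
      then have "deg_Inr c \<le> deg_Inl c" by simp
      then show ?thesis using c conv_D_complete_bipartite_Inl[of c K] by blast
    qed
  next
    assume ?R
    then show ?L
    proof (elim disjE exE conjE)
      fix c assume "\<forall>i. 0 < c i" "deg_Inl c \<le> deg_Inr c" "P = cap_poly c (range Inr) (deg_Inl c)"
      then show ?L using conv_D_complete_bipartite_Inr[of c K] by blast
    next
      fix c assume "\<forall>i. 0 < c i" "deg_Inr c \<le> deg_Inl c" "P = cap_poly c (range Inl) (deg_Inr c)"
      then show ?L using conv_D_complete_bipartite_Inl[of c K] by blast
    qed
  qed
  then show ?thesis
    by (auto simp: gorenstein_bipartite_polytopes_def listed_at_eq[OF _ card'] Compl_range_Inl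
        Compl_range_Inr sum_range_Inl sum_range_Inr)
qed

section \<open>Comparison with the listed families\<close>

lemma unit_cube_eq: "unit_cube = {x. \<forall>i. 0 \<le> x $ i \<and> x $ i \<le> real 1}"
  by (simp add: unit_cube_def)

lemma translated_centred_cube_eq:
  "(\<lambda>x. x + 1) ` centred_cube = {x. \<forall>i. 0 \<le> x $ i \<and> x $ i \<le> real 2}"
proof (intro equalityI subsetI)
  fix x :: "real ^ 'a" assume "x \<in> {x. \<forall>i. 0 \<le> x $ i \<and> x $ i \<le> real 2}"
  then have "(1/2) *\<^sub>R x \<in> unit_cube" by (simp add: unit_cube_def)
  moreover have "x = 2 *\<^sub>R ((1/2) *\<^sub>R x) - 1 + 1" by simp
  ultimately show "x \<in> (\<lambda>x. x + 1) ` centred_cube" unfolding centred_cube_def by blast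
qed (auto simp: centred_cube_def unit_cube_def)

lemma listed_polytopes_eq:
  "(listed_polytopes :: (real ^ ('m::finite + 'n::finite)) set set) = listed_at (range Inr)"
proof -
  have cardT: "card (range (Inr :: 'n \<Rightarrow> 'm + 'n)) = CARD('n)"
    "card (range (Inl :: 'm \<Rightarrow> 'm + 'n)) = CARD('m)"
    by (simp_all add: card_image)
  have ex1: "(\<exists>c. family1 c P) \<longleftrightarrow> CARD('n) = CARD('m) \<and>
      (P = unit_cube \<or> P = (\<lambda>x. x + 1) ` centred_cube)" for P :: "(real ^ ('m + 'n)) set"
    unfolding family1_def by auto
  \<comment> \<open>The bound vector is determined by \<open>A\<close>, so its quantifier can be
    eliminated.\<close>
  have ex_fun: "(\<exists>c A. (\<forall>i. c i = f A i) \<and> R A \<or> (\<forall>i. c i = g A i) \<and> S A) \<longleftrightarrow> (\<exists>A. R A \<or> S A)"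
    for f g :: "'n set \<Rightarrow> 'm + 'n \<Rightarrow> nat" and R S
    by (auto simp: fun_eq_iff[symmetric])
  have sub: "(\<exists>A\<subseteq>range Inr. Q A) \<longleftrightarrow> (\<exists>A. Q (Inr ` A))" for Q :: "('m + 'n) set \<Rightarrow> bool"
    by (auto simp: subset_image_iff)
  have ex2: "(\<exists>c. family2 c P) \<longleftrightarrow> CARD('m) \<ge> 2 \<and> CARD('n) = 2 * CARD('m) - 1 \<and>
     (\<exists>A :: 'n set.
        P = {x. (\<forall>i. 0 \<le> x $ i) \<and> (\<forall>i. i \<notin> Inr ` A \<longrightarrow> x $ i \<le> 1) \<and>
                (\<Sum>j\<in>UNIV. x $ Inr j) \<le> real CARD('m)} \<or>
        P = {x. (\<forall>i. 0 \<le> x $ i) \<and> (\<forall>i. i \<notin> Inr ` A \<longrightarrow> x $ i \<le> 2) \<and>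
                (\<Sum>j\<in>UNIV. x $ Inr j) \<le> 2 * real CARD('m)})" for P :: "(real ^ ('m + 'n)) set"
    unfolding family2_def by (simp only: ex_simps ex_fun)
  show ?thesis
    unfolding listed_polytopes_def ex_disj_distrib ex1 ex2 unit_cube_eq translated_centred_cube_eq
    unfolding listed_at_def Compl_range_Inr sum_range_Inr cardT
    by (intro Collect_cong) (simp add: sub, blast)
qed

section \<open>Exchange of the two parts\<close>

lemma mem_swap_parts_iff:
  "x \<in> swap_parts P \<longleftrightarrow> (\<chi> i. x $ case_sum Inr Inl i) \<in> P"
proof
  assume "(\<chi> i. x $ case_sum Inr Inl i) \<in> P"
  moreover have "x = (\<chi> i. (\<chi> i. x $ case_sum Inr Inl i) $ (case i of Inl k \<Rightarrow> Inr k | Inr k \<Rightarrow> Inl k))"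
    by (auto simp: vec_eq_iff split: sum.split)
  ultimately show "x \<in> swap_parts P" unfolding swap_parts_def by blast
next
  assume "x \<in> swap_parts P"
  then obtain y where "y \<in> P" "x = (\<chi> i. y $ (case i of Inl k \<Rightarrow> Inr k | Inr k \<Rightarrow> Inl k))"
    unfolding swap_parts_def by blast
  moreover from this have "(\<chi> i. x $ case_sum Inr Inl i) = y"
    by (auto simp: vec_eq_iff split: sum.split)
  ultimately show "(\<chi> i. x $ case_sum Inr Inl i) \<in> P" by simp
qed

lemma swap_parts_swap_parts: "swap_parts (swap_parts P) = P"
proof -
  have "(\<chi> i. (\<chi> i. x $ case_sum Inr Inl i) $ case_sum Inr Inl i) = x" for x :: "real ^ ('a + 'b)"
    by (auto simp: vec_eq_iff split: sum.split)
  then show ?thesis by (auto simp: mem_swap_parts_iff)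
qed

text \<open>The description of \<open>listed_at T\<close> uses only \<open>T\<close>, subsets of it
  and cardinalities, all of which are carried along by a bijection of the coordinates.\<close>

lemma swap_parts_listed_at:
  assumes "P \<in> listed_at T"
  shows "swap_parts P \<in> listed_at (case_sum Inr Inl ` T)"
proof -
  let ?\<sigma> = "case_sum Inr Inl :: 'a + 'b \<Rightarrow> 'b + 'a"
  have "case_sum Inr Inl (?\<sigma> i) = i" "?\<sigma> (case_sum Inr Inl j) = j" for i j
    by (cases i, simp_all) (cases j, simp_all)
  then have \<sigma>: "bij ?\<sigma>" by (intro o_bij[of "case_sum Inr Inl"]) (simp_all add: fun_eq_iff)
  have card: "card (?\<sigma> ` T) = card T" "card (- (?\<sigma> ` T)) = card (- T)"
    using \<sigma> by (simp_all add: bij_image_Compl_eq[symmetric] card_image bij_is_inj inj_on_subset[OF bij_is_inj])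
  have all: "(\<forall>i. Q (?\<sigma> i)) \<longleftrightarrow> (\<forall>i. Q i)" for Q using bij_is_surj[OF \<sigma>] by (metis surjD)
  have sum: "(\<Sum>i\<in>?\<sigma> ` T. x $ i) = (\<Sum>i\<in>T. x $ ?\<sigma> i)" for x :: "real ^ ('b + 'a)"
    using \<sigma> by (simp add: sum.reindex inj_on_subset[OF bij_is_inj])
  have mem: "?\<sigma> i \<in> ?\<sigma> ` A \<longleftrightarrow> i \<in> A" for i A using \<sigma> by (simp add: inj_image_mem_iff bij_is_inj)
  from assms show ?thesis
  proof (cases rule: listed_atE)
    case (box e)
    have "(\<forall>i. 0 \<le> x $ ?\<sigma> i \<and> x $ ?\<sigma> i \<le> real e) \<longleftrightarrow> (\<forall>i. 0 \<le> x $ i \<and> x $ i \<le> real e)"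
      for x :: "real ^ ('b + 'a)"
      using all[of "\<lambda>i. 0 \<le> x $ i \<and> x $ i \<le> real e"] .
    then have "swap_parts P = {x. \<forall>i. 0 \<le> x $ i \<and> x $ i \<le> real e}"
      by (simp add: set_eq_iff mem_swap_parts_iff box(3))
    then show ?thesis unfolding listed_at_def using box(2) card
      by (intro CollectI bexI[OF _ box(1)] disjI1) simp
  next
    case A: (cap e A)
    have "(\<forall>i. i \<notin> A \<longrightarrow> x $ ?\<sigma> i \<le> real e) \<longleftrightarrow> (\<forall>i. i \<notin> ?\<sigma> ` A \<longrightarrow> x $ i \<le> real e)"
      for x :: "real ^ ('b + 'a)"
      using all[of "\<lambda>i. i \<notin> ?\<sigma> ` A \<longrightarrow> x $ i \<le> real e"] by (simp add: mem)
    moreover have "(\<forall>i. 0 \<le> x $ ?\<sigma> i) \<longleftrightarrow> (\<forall>i. 0 \<le> x $ i)" for x :: "real ^ ('b + 'a)"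
      using all[of "\<lambda>i. 0 \<le> x $ i"] .
    ultimately have "swap_parts P = {x. (\<forall>i. 0 \<le> x $ i) \<and>
        (\<forall>i. i \<notin> ?\<sigma> ` A \<longrightarrow> x $ i \<le> real e) \<and> (\<Sum>i\<in>?\<sigma> ` T. x $ i) \<le> real (e * card (- (?\<sigma> ` T)))}"
      by (simp add: set_eq_iff mem_swap_parts_iff A(5) sum card)
    moreover have "?\<sigma> ` A \<subseteq> ?\<sigma> ` T" using A(2) by blast
    ultimately show ?thesis unfolding listed_at_def using A(3,4) card
      by (intro CollectI bexI[OF _ A(1)] disjI2 exI[of _ "?\<sigma> ` A"]) simp
  qed
qed

lemma swap_parts_image_listed_at:
  "swap_parts ` listed_at (range Inr :: ('n::finite + 'm::finite) set) = listed_at (range Inl)"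
proof -
  have mem: "swap_parts P \<in> listed_at (range Inl)" if "P \<in> listed_at (range Inr :: ('n + 'm) set)" for P
    using swap_parts_listed_at[OF that] by (simp add: image_image)
  have mem': "swap_parts P \<in> listed_at (range Inr)" if "P \<in> listed_at (range Inl :: ('m + 'n) set)" for P
    using swap_parts_listed_at[OF that] by (simp add: image_image)
  show ?thesis
  proof
    show "listed_at (range Inl) \<subseteq> swap_parts ` listed_at (range Inr :: ('n + 'm) set)"
    proof
      fix P assume "P \<in> listed_at (range Inl :: ('m + 'n) set)"
      then show "P \<in> swap_parts ` listed_at (range Inr)"
        using mem' by (intro image_eqI[of _ _ "swap_parts P"]) (simp_all add: swap_parts_swap_parts)
    qed
  qed (use mem in blast)
qed

lemma family_eq_conv_D:
  fixes P :: "(real ^ ('m::finite + 'n::finite)) set"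
  assumes "family1 c P \<or> family2 c P"
  shows "P = conv_D K complete_bipartite c"
  using assms
proof
  assume f1: "family1 c P"
  then obtain e where e: "0 < e" "c = (\<lambda>_. e)" "P = {x. \<forall>i. 0 \<le> x $ i \<and> x $ i \<le> real e}"
    unfolding family1_def unit_cube_eq translated_centred_cube_eq fun_eq_iff
    by (elim conjE disjE) (blast intro: zero_less_one zero_less_numeral)+
  moreover have "CARD('m) = CARD('n)" using f1 by (simp add: family1_def)
  ultimately show ?thesis
    using conv_D_complete_bipartite_Inr[of c K] cap_poly_const_eq_box[of e "range Inr :: ('m + 'n) set"]
    by (simp add: card_image)
next
  assume f2: "family2 c P"
  define m where "m = CARD('m)"
  from f2 have mn: "2 \<le> m" "CARD('n) = 2 * m - 1" by (auto simp: family2_def m_def)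
  \<comment> \<open>Both halves of the second family are handled at once, with scale
    \<open>e\<close> equal to 1 or 2. The left sum is then \<open>e * m\<close> and the right sum at
    least \<open>e * (2 * m - 1)\<close>, so the cap belongs to the right part.\<close>
  obtain A :: "'n set" and e :: nat where e: "e = 1 \<or> e = 2"
    and c: "\<And>i. c i = (if i \<in> Inr ` A then e * m else e)"
    and P: "P = {x. (\<forall>i. 0 \<le> x $ i) \<and> (\<forall>i. i \<notin> Inr ` A \<longrightarrow> x $ i \<le> real e) \<and>
                (\<Sum>j\<in>UNIV. x $ Inr j) \<le> real (e * m)}"
  proof -
    from f2 consider
      A :: "'n set" where "\<forall>i. c i = (if i \<in> Inr ` A then m else 1)"
        "P = {x. (\<forall>i. 0 \<le> x $ i) \<and> (\<forall>i. i \<notin> Inr ` A \<longrightarrow> x $ i \<le> 1) \<and>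
                (\<Sum>j\<in>UNIV. x $ Inr j) \<le> real m}"
    | A :: "'n set" where "\<forall>i. c i = (if i \<in> Inr ` A then 2 * m else 2)"
        "P = {x. (\<forall>i. 0 \<le> x $ i) \<and> (\<forall>i. i \<notin> Inr ` A \<longrightarrow> x $ i \<le> 2) \<and>
                (\<Sum>j\<in>UNIV. x $ Inr j) \<le> 2 * real m}"
      unfolding family2_def m_def by blast
    then show thesis
    proof cases
      case (1 A)
      show thesis by (rule that[of 1 A]) (simp_all add: 1)
    next
      case (2 A)
      show thesis by (rule that[of 2 A]) (simp_all add: 2)
    qed
  qed
  have Inl: "deg_Inl c = e * m" by (auto simp: c m_def image_iff)
  have "e * m \<le> e * CARD('n)" using mn by (intro mult_le_mono) auto
  also have "\<dots> = (\<Sum>j\<in>(UNIV :: 'n set). e)" by simp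
  also have "\<dots> \<le> deg_Inr c" using mn by (intro sum_mono) (auto simp: c)
  finally have "deg_Inl c \<le> deg_Inr c" using Inl by simp
  moreover have "0 < c i" for i using e mn by (auto simp: c)
  ultimately have "conv_D K complete_bipartite c = cap_poly c (range Inr) (e * m)"
    using conv_D_complete_bipartite_Inr[of c K] Inl by simp
  also have "\<dots> = P"
    unfolding P sum_range_Inr[symmetric] by (rule cap_poly_drop_bounds) (auto simp: c)
  finally show ?thesis by simp
qed

text \<open>The first conjunct ties each listed polytope to its bound vector. If
  \<open>CARD('m) = 2 * CARD('n) - 1\<close>, vectors whose smaller sum is on the right give further
  Gorenstein polytopes; the last conjunct covers them through the exchange of parts.\<close>

theorem theorem5p3:
  fixes K :: "'k::field itself"
  assumes "CARD('m::finite) + CARD('n::finite) \<ge> 3"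
  shows "(\<forall>c (P :: (real ^ ('m + 'n)) set). family1 c P \<or> family2 c P \<longrightarrow>
            P = conv_D K complete_bipartite c) \<and>
         (CARD('m) \<noteq> 2 * CARD('n) - 1 \<longrightarrow>
            gorenstein_bipartite_polytopes K =
              (listed_polytopes :: (real ^ ('m + 'n)) set set)) \<and>
         gorenstein_bipartite_polytopes K =
           (listed_polytopes :: (real ^ ('m + 'n)) set set) \<union>
           swap_parts ` (listed_polytopes :: (real ^ ('n + 'm)) set set)"
proof (intro conjI allI impI)
  show "P = conv_D K complete_bipartite c" if "family1 c P \<or> family2 c P"
    for c and P :: "(real ^ ('m + 'n)) set"
    using family_eq_conv_D[OF that] .
  show "gorenstein_bipartite_polytopes K = (listed_polytopes :: (real ^ ('m + 'n)) set set) \<union>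
      swap_parts ` (listed_polytopes :: (real ^ ('n + 'm)) set set)"
    unfolding listed_polytopes_eq swap_parts_image_listed_at
    by (rule gorenstein_bipartite_polytopes_eq[OF assms])
  assume "CARD('m) \<noteq> 2 * CARD('n) - 1"
  \<comment> \<open>The boxes do not depend on which part is capped, and the genuinely capped
    polytopes on the left require the excluded equation between the part sizes.\<close>
  have "P \<in> listed_at (range Inr)" if "P \<in> listed_at (range Inl)" for P :: "(real ^ ('m + 'n)) set"
  proof -
    have cardT: "card (range (Inl :: 'm \<Rightarrow> 'm + 'n)) = CARD('m)"
      "card (range (Inr :: 'n \<Rightarrow> 'm + 'n)) = CARD('n)"
      by (simp_all add: card_image)
    show ?thesis using that
    proof (cases rule: listed_atE)
      case (box e)
      then show ?thesis unfolding listed_at_def Compl_range_Inl Compl_range_Inr cardT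
        by (intro CollectI bexI[OF _ box(1)] disjI1) simp
    next
      case (cap e A)
      then show ?thesis
        using \<open>CARD('m) \<noteq> 2 * CARD('n) - 1\<close> unfolding Compl_range_Inl cardT by simp
    qed
  qed
  then show "gorenstein_bipartite_polytopes K = (listed_polytopes :: (real ^ ('m + 'n)) set set)"
    unfolding listed_polytopes_eq gorenstein_bipartite_polytopes_eq[OF assms] by blast
qed

end
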